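(* Let $n\ge 3$ and let $\ell\ge 1$ be an odd integer with $\ell\le \frac{n}{2}$. Then there is no subspace extension $Q\subseteq\mathbb{R}^d$ of $\mathrm{P}_{\mathrm{match}}^{\ell}(n)$ that is coordinate-symmetric with respect to $\mathfrak{S}(n)$ (acting by permuting the nodes of $K_n$) and has at most $\binom{n}{(\ell-1)/2}$ variables, i.e., with $d\le\binom{n}{(\ell-1)/2}$.
   Context: $K_n=([n],E_n)$ is the complete graph on $[n]=\{1,\dots,n\}$. $\mathcal{M}^{\ell}(n)$ is the set of all matchings $M\subseteq E_n$ (sets of edges no two of which share a node) with $|M|=\ell$; $\chi(M)\in\{0,1\}^{E_n}$ is the characteristic vector of $M$; and $\mathrm{P}_{\mathrm{match}}^{\ell}(n)=\operatorname{conv}\{\chi(M): M\in\mathcal{M}^{\ell}(n)\}\subseteq\mathbb{R}^{E_n}$. The symmetric group $\mathfrak{S}(n)$ acts on $E_n$ by $\pi.\{v,w\}=\{\pi(v),\pi(w)\}$ and hence on $\mathbb{R}^{E_n}$ by $(\pi.x)_{\{v,w\}}=x_{\{\pi^{-1}(v),\pi^{-1}(w)\}}$; this action maps $\mathrm{P}_{\mathrm{match}}^{\ell}(n)$ to itself. An extension of a polytope $P\subseteq\mathbb{R}^m$ is a polyhedron $Q\subseteq\mathbb{R}^d$ together with an affine map $p:\mathbb{R}^d\to\mathbb{R}^m$ with $p(Q)=P$. It is a subspace extension if $Q$ is the intersection of an affine subspace of $\mathbb{R}^d$ with the nonnegative orthant $\mathbb{R}_+^d$. $\mathfrak{S}(d)$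 acts on $\mathbb{R}^d$ by coordinate permutations, $(\sigma.y)_j=y_{\sigma^{-1}(j)}$. If $G$ is a group of affine transformations $\pi$ of $\mathbb{R}^m$ with $\pi.P=P$, the extension is coordinate-symmetric with respect to $G$ if for every $\pi\in G$ there is $\varkappa_\pi\in\mathfrak{S}(d)$ with $\varkappa_\pi.Q=Q$ and $p(\varkappa_\pi.y)=\pi.p(y)$ for all $y\in Q$. *)

theory Defs
  imports
    "HOL-Analysis.Analysis"
    "HOL-Library.Function_Algebras"
    "HOL-Library.Disjoint_Sets"
    "HOL-Combinatorics.Permutations"
begin

text \<open>
  The dimension \<open>d\<close> has to be quantified inside the statement (and may be 0), so coordinate
  spaces are not indexed by types: \<open>\<real>\<^sup>I\<close> is the linear subspace \<^term>\<open>coord_space I\<close> of the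
  pointwise vector space of all functions \<^typ>\<open>'i \<Rightarrow> real\<close>. The instance below makes the
  library notions \<^const>\<open>linear\<close>, \<^const>\<open>affine\<close> and \<open>convex hull\<close> available there.
\<close>

instantiation "fun" :: (type, real_vector) real_vector
begin

definition "c *\<^sub>R f = (\<lambda>x. c *\<^sub>R f x)"

instance
  by standard (auto simp: scaleR_fun_def fun_eq_iff scaleR_add_right scaleR_add_left)

end

lemma scaleR_fun_apply [simp]: "(c *\<^sub>R f) x = c *\<^sub>R f x"
  by (simp add: scaleR_fun_def)

definition coord_space :: "'i set \<Rightarrow> ('i \<Rightarrow> real) set" where
  "coord_space I = {x. \<forall>i. i \<notin> I \<longrightarrow> x i = 0}"

definition nonneg_orthant :: "'i set \<Rightarrow> ('i \<Rightarrow> real) set" where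
  "nonneg_orthant I = {x \<in> coord_space I. \<forall>i\<in>I. 0 \<le> x i}"

definition polyhedron_in :: "'i set \<Rightarrow> ('i \<Rightarrow> real) set \<Rightarrow> bool" where
  "polyhedron_in I Q \<longleftrightarrow>
     (\<exists>H :: (('i \<Rightarrow> real) \<times> real) set. finite H \<and>
        Q = {x \<in> coord_space I. \<forall>(a, b)\<in>H. (\<Sum>i\<in>I. a i * x i) \<le> b})"

text \<open>Only the values of \<open>p\<close> on \<^term>\<open>coord_space I\<close> matter.\<close>

definition affine_map ::
    "'i set \<Rightarrow> 'j set \<Rightarrow> (('i \<Rightarrow> real) \<Rightarrow> ('j \<Rightarrow> real)) \<Rightarrow> bool" where
  "affine_map I J p \<longleftrightarrow>
     p ` coord_space I \<subseteq> coord_space J \<and>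
     (\<exists>f c. linear f \<and> (\<forall>y\<in>coord_space I. p y = f y + c))"

definition is_extension ::
    "nat \<Rightarrow> (nat \<Rightarrow> real) set \<Rightarrow> ((nat \<Rightarrow> real) \<Rightarrow> ('j \<Rightarrow> real)) \<Rightarrow> 'j set \<Rightarrow> ('j \<Rightarrow> real) set \<Rightarrow> bool"
  where
  "is_extension d Q p J P \<longleftrightarrow>
     polyhedron_in {1..d} Q \<and> affine_map {1..d} J p \<and> p ` Q = P"

definition is_subspace_extension ::
    "nat \<Rightarrow> (nat \<Rightarrow> real) set \<Rightarrow> ((nat \<Rightarrow> real) \<Rightarrow> ('j \<Rightarrow> real)) \<Rightarrow> 'j set \<Rightarrow> ('j \<Rightarrow> real) set \<Rightarrow> bool"
  where
  "is_subspace_extension d Q p J P \<longleftrightarrow>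
     is_extension d Q p J P \<and>
     (\<exists>A. affine A \<and> A \<subseteq> coord_space {1..d} \<and> Q = A \<inter> nonneg_orthant {1..d})"

definition permute_coords :: "('i \<Rightarrow> 'i) \<Rightarrow> ('i \<Rightarrow> real) \<Rightarrow> ('i \<Rightarrow> real)" where
  "permute_coords \<sigma> y = (\<lambda>j. y (inv \<sigma> j))"

definition coordinate_symmetric ::
    "nat \<Rightarrow> (nat \<Rightarrow> real) set \<Rightarrow> ((nat \<Rightarrow> real) \<Rightarrow> ('j \<Rightarrow> real)) \<Rightarrow> (('j \<Rightarrow> real) \<Rightarrow> ('j \<Rightarrow> real)) set \<Rightarrow> bool"
  where
  "coordinate_symmetric d Q p G \<longleftrightarrow>
     (\<forall>g\<in>G. \<exists>\<kappa>. \<kappa> permutes {1..d} \<and> permute_coords \<kappa> ` Q = Q \<and>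
        (\<forall>y\<in>Q. p (permute_coords \<kappa> y) = g (p y)))"

definition complete_edges :: "nat \<Rightarrow> nat set set" where
  "complete_edges n = {{v, w} | v w. v \<in> {1..n} \<and> w \<in> {1..n} \<and> v \<noteq> w}"

definition matchings :: "nat \<Rightarrow> nat \<Rightarrow> nat set set set" where
  "matchings l n = {M. M \<subseteq> complete_edges n \<and> disjoint M \<and> card M = l}"

definition match_polytope :: "nat \<Rightarrow> nat \<Rightarrow> (nat set \<Rightarrow> real) set" where
  "match_polytope l n = convex hull ((\<lambda>M. indicator M) ` matchings l n)"

definition node_action :: "(nat \<Rightarrow> nat) \<Rightarrow> (nat set \<Rightarrow> real) \<Rightarrow> (nat set \<Rightarrow> real)" where
  "node_action \<pi> x = (\<lambda>e. x (inv \<pi> ` e))"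

definition node_symmetries :: "nat \<Rightarrow> ((nat set \<Rightarrow> real) \<Rightarrow> (nat set \<Rightarrow> real)) set" where
  "node_symmetries n = {node_action \<pi> | \<pi>. \<pi> permutes {1..n}}"

lemma node_action_indicator:
  assumes "\<pi> permutes {1..n}"
  shows "node_action \<pi> (indicator M) = indicator ((`) \<pi> ` M)"
proof
  fix e
  have b: "bij \<pi>" using assms by (rule permutes_bij)
  have "inv \<pi> ` e \<in> M \<longleftrightarrow> e \<in> (`) \<pi> ` M"
  proof
    assume "inv \<pi> ` e \<in> M"
    moreover have "e = \<pi> ` (inv \<pi> ` e)" using b by (simp add: image_f_inv_f bij_is_surj)
    ultimately show "e \<in> (`) \<pi> ` M" by blast
  next
    assume "e \<in> (`) \<pi> ` M"
    then obtain f where "f \<in> M" "e = \<pi> ` f" by blast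
    then show "inv \<pi> ` e \<in> M" using b by (simp add: image_inv_f_f bij_is_inj)
  qed
  then show "node_action \<pi> (indicator M) e = (indicator ((`) \<pi> ` M) e :: real)"
    by (simp add: node_action_def indicator_def)
qed

lemma image_matching:
  assumes "\<pi> permutes {1..n}" "M \<in> matchings l n"
  shows "(`) \<pi> ` M \<in> matchings l n"
proof -
  have i: "inj \<pi>" using assms(1) by (rule permutes_inj)
  have "(`) \<pi> ` M \<subseteq> complete_edges n"
  proof
    fix e assume "e \<in> (`) \<pi> ` M"
    then obtain f where "f \<in> complete_edges n" and e: "e = \<pi> ` f"
      using assms(2) unfolding matchings_def by blast
    then obtain v w where vw: "v \<in> {1..n}" "w \<in> {1..n}" "v \<noteq> w" and f: "f = {v, w}"
      unfolding complete_edges_def by blast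
    have "e = {\<pi> v, \<pi> w}" using e f by simp
    moreover have "\<pi> v \<in> {1..n}" "\<pi> w \<in> {1..n}"
      using vw permutes_in_image[OF assms(1)] by blast+
    moreover have "\<pi> v \<noteq> \<pi> w" using vw(3) i by (simp add: inj_eq)
    ultimately show "e \<in> complete_edges n" unfolding complete_edges_def by blast
  qed
  moreover have "disjoint ((`) \<pi> ` M)"
  proof (rule disjointI)
    fix a b assume "a \<in> (`) \<pi> ` M" "b \<in> (`) \<pi> ` M" "a \<noteq> b"
    then obtain e f where ef: "e \<in> M" "f \<in> M" "e \<noteq> f" "a = \<pi> ` e" "b = \<pi> ` f" by blast
    then have "e \<inter> f = {}" using assms(2) by (auto simp: matchings_def disjoint_def)
    then show "a \<inter> b = {}" using ef i by (simp add: image_Int[symmetric])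
  qed
  moreover have "card ((`) \<pi> ` M) = l"
  proof -
    have "inj_on ((`) \<pi>) M" using i by (simp add: inj_on_def inj_image_eq_iff)
    then show ?thesis using assms(2) by (simp add: matchings_def card_image)
  qed
  ultimately show ?thesis by (simp add: matchings_def)
qed

lemma node_symmetries_match_polytope:
  assumes "g \<in> node_symmetries n"
  shows "g ` match_polytope l n = match_polytope l n"
proof -
  obtain \<pi> where p: "\<pi> permutes {1..n}" and g: "g = node_action \<pi>"
    using assms by (auto simp: node_symmetries_def)
  have lin: "linear g"
    unfolding g node_action_def by (rule linearI) (auto simp: fun_eq_iff)
  have q: "inv \<pi> permutes {1..n}" using p by (rule permutes_inv)
  have "(`) ((`) \<pi>) ` matchings l n = matchings l n"
  proof
    show "(`) ((`) \<pi>) ` matchings l n \<subseteq> matchings l n" using image_matching[OF p] by blast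
    show "matchings l n \<subseteq> (`) ((`) \<pi>) ` matchings l n"
    proof
      fix M assume "M \<in> matchings l n"
      then have "(`) (inv \<pi>) ` M \<in> matchings l n" by (rule image_matching[OF q])
      moreover have "M = (`) \<pi> ` ((`) (inv \<pi>) ` M)"
        by (simp add: image_image permutes_inverses(1)[OF p])
      ultimately show "M \<in> (`) ((`) \<pi>) ` matchings l n" by blast
    qed
  qed
  moreover have "g ` (\<lambda>M. indicator M) ` matchings l n
      = (\<lambda>M. indicator M) ` (`) ((`) \<pi>) ` matchings l n"
    by (simp add: image_image g node_action_indicator[OF p])
  ultimately show ?thesis
    by (simp add: match_polytope_def convex_hull_linear_image[OF lin])
qed

end

theory Submission
  imports Defs "HOL-Computational_Algebra.Polynomial"
begin

text \<open>
  Averaging over coordinate permutations gives points \<open>s(M) \<in> Q\<close> above the vertices \<open>\<chi>(M)\<close> such that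
  a permutation of the nodes permutes the coordinate functions \<open>M \<mapsto> s(M)\<^sub>j\<close>. There are at most
  \<open>n choose k\<close> of them, where \<open>l = 2k + 1\<close>, so the stabilizer of each has index at most
  \<open>n choose k\<close> in the symmetric group, and hence contains the alternating group on all but at most
  \<open>k\<close> nodes.

  Fix disjoint node sets \<open>A\<close>, \<open>B\<close> of odd size \<open>l\<close>, and average \<open>s(M)\<^sub>j\<close> over the perfect matchings of
  \<open>A \<union> B\<close> with exactly \<open>i\<close> edges between \<open>A\<close> and \<open>B\<close>. By locality the average is a polynomial in \<open>i\<close> of
  degree at most \<open>k\<close>, and the value of this polynomial at \<open>i = 0\<close> is nonnegative, because at most
  \<open>k < l / 2\<close> nodes matter and they cannot tell that \<open>A\<close> and \<open>B\<close> are odd. Interpolating from the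
  \<open>k + 1\<close> values \<open>i = 1, 3, \<dots>, l\<close> thus yields an affine combination of the \<open>s(M)\<close> that lies in
  \<open>Q\<close>, but whose image violates the odd cut inequality for \<open>A\<close>, \<open>B\<close>.

  This needs \<open>k \<ge> 1\<close>, and it fails for \<open>n = 6\<close>, \<open>k = 1\<close>, because of the exotic subgroups of index 6
  in the symmetric group on 6 points. For \<open>k = 0\<close> no coordinate can be permuted, and for
  \<open>n = 6\<close>, \<open>k = 1\<close> the dimension of the polytope exceeds 6.
\<close>

section \<open>Permutation groups of small index\<close>

definition perm_group :: "'a set \<Rightarrow> ('a \<Rightarrow> 'a) set \<Rightarrow> bool" where
  "perm_group S U \<longleftrightarrow> (\<forall>g\<in>U. g permutes S) \<and> id \<in> U \<and>
     (\<forall>g\<in>U. \<forall>h\<in>U. g \<circ> h \<in> U) \<and> (\<forall>g\<in>U. inv g \<in> U)"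

lemma perm_groupD:
  assumes "perm_group S U"
  shows "g \<in> U \<Longrightarrow> g permutes S" "id \<in> U" "g \<in> U \<Longrightarrow> h \<in> U \<Longrightarrow> g \<circ> h \<in> U"
    "g \<in> U \<Longrightarrow> inv g \<in> U"
  using assms by (auto simp: perm_group_def)

lemma perm_group_subset: "perm_group S U \<Longrightarrow> U \<subseteq> {g. g permutes S}"
  by (auto simp: perm_group_def)

lemma perm_group_finite: "perm_group S U \<Longrightarrow> finite S \<Longrightarrow> finite U"
  using perm_group_subset finite_permutations finite_subset by metis

lemma perm_group_card_pos: "perm_group S U \<Longrightarrow> finite S \<Longrightarrow> 0 < card U"
  using perm_group_finite perm_groupD(2) card_gt_0_iff by blast

lemma perm_group_card_le: "perm_group S U \<Longrightarrow> finite S \<Longrightarrow> card U \<le> fact (card S)"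
  by (metis card_mono card_permutations finite_permutations perm_group_subset)

lemma perm_group_Sym: "perm_group S {g. g permutes S}"
  by (auto simp: perm_group_def permutes_id permutes_compose permutes_inv)

lemma perm_group_Int_Sym:
  assumes "perm_group S U"
  shows "perm_group T (U \<inter> {g. g permutes T})"
  using assms by (auto simp: perm_group_def permutes_id permutes_compose permutes_inv)

lemma perm_group_stabilizer:
  assumes "perm_group S U"
  shows "perm_group S {g \<in> U. g x = x}"
  using assms unfolding perm_group_def
  by (auto simp: permutes_inv_eq)

text \<open>Left multiplication by the inverse of a representative maps each fibre of
  \<open>f\<close> injectively into \<open>K\<close>. This serves as the orbit-stabilizer bound:
  \<open>f\<close> will be evaluation at a point, restriction to a subset, or translation of a
  coordinate function.\<close>

lemma card_le_image_times_card:
  assumes U: "perm_group S U" and K: "finite K" and S: "finite S"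
    and f: "\<And>g h. g \<in> U \<Longrightarrow> h \<in> U \<Longrightarrow> f g = f h \<Longrightarrow> inv g \<circ> h \<in> K"
  shows "card U \<le> card (f ` U) * card K"
proof -
  have fU: "finite (f ` U)" using perm_group_finite[OF U S] by blast
  define r where "r y = (SOME g. g \<in> U \<and> f g = y)" for y
  have r: "r (f g) \<in> U" "f (r (f g)) = f g" if "g \<in> U" for g
    unfolding r_def using someI_ex[of "\<lambda>h. h \<in> U \<and> f h = f g"] that by auto
  have "U \<subseteq> (\<lambda>(y, u). r y \<circ> u) ` (f ` U \<times> K)"
  proof
    fix h assume h: "h \<in> U"
    let ?g = "r (f h)"
    have "inv ?g \<circ> h \<in> K" using f r h by metis
    moreover have "h = ?g \<circ> (inv ?g \<circ> h)"
      using permutes_inv_o(1)[OF perm_groupD(1)[OF U r(1)[OF h]]] by (simp add: o_assoc)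
    ultimately show "h \<in> (\<lambda>(y, u). r y \<circ> u) ` (f ` U \<times> K)"
      using h by (intro image_eqI[of _ _ "(f h, inv ?g \<circ> h)"]) auto
  qed
  then have "card U \<le> card (f ` U \<times> K)"
    by (meson K fU card_image_le card_mono finite_SigmaI finite_imageI le_trans)
  then show ?thesis by (simp add: card_cartesian_product)
qed

text \<open>Restriction to the invariant set \<open>J\<close> maps \<open>U\<close> into the
  symmetric group on \<open>J\<close>, and elements with the same restriction differ by one that
  fixes \<open>J\<close> pointwise.\<close>

lemma card_le_fact_times_pointwise_stabilizer:
  assumes U: "perm_group S U" and S: "finite S" and J: "J \<subseteq> S"
    and inv: "\<And>g. g \<in> U \<Longrightarrow> g ` J \<subseteq> J"
  shows "card U \<le> fact (card J) * card (U \<inter> {g. g permutes (S - J)})"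
proof -
  define f where "f g = (\<lambda>x. if x \<in> J then g x else x)" for g :: "'a \<Rightarrow> 'a"
  have fJ: "finite J" using J S finite_subset by blast
  have "f g permutes J" if "g \<in> U" for g
  proof (rule bij_imp_permutes)
    have "inj_on g J" using perm_groupD(1)[OF U that] by (meson permutes_inj_on)
    then have "bij_betw g J J" using inv[OF that] fJ
      by (simp add: bij_betw_def endo_inj_surj)
    then show "bij_betw (f g) J J" unfolding f_def by (simp cong: bij_betw_cong)
  qed (auto simp: f_def)
  then have "card (f ` U) \<le> fact (card J)"
    using card_permutations[OF refl fJ] finite_permutations[OF fJ]
    by (metis card_mono image_subsetI mem_Collect_eq)
  moreover have "card U \<le> card (f ` U) * card (U \<inter> {g. g permutes (S - J)})"
  proof (rule card_le_image_times_card[OF U _ S])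
    show "finite (U \<inter> {g. g permutes (S - J)})" using perm_group_finite[OF U S] by blast
    fix g h assume g: "g \<in> U" and h: "h \<in> U" and e: "f g = f h"
    have u: "inv g \<circ> h \<in> U" using perm_groupD[OF U] g h by blast
    have "(inv g \<circ> h) x = x" if "x \<in> J" for x
    proof -
      have "g x = h x" using fun_cong[OF e, of x] that by (simp add: f_def)
      then show ?thesis using perm_groupD(1)[OF U g]
        by (metis comp_apply permutes_inverses(2))
    qed
    then have "inv g \<circ> h permutes (S - J)"
      by (intro permutes_superset[OF perm_groupD(1)[OF U u]]) auto
    with u show "inv g \<circ> h \<in> U \<inter> {g. g permutes (S - J)}" by blast
  qed
  ultimately show ?thesis by (meson le_trans mult_le_mono1)
qed

text \<open>Since \<open>U\<close> meets the symmetric group on \<open>T\<close> only in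
  \<open>id\<close>, the products \<open>t \<circ> u\<close> are pairwise distinct permutations of
  \<open>S\<close>.\<close>

lemma fact_mult_card_le:
  assumes U: "perm_group S U" and S: "finite S" and T: "T \<subseteq> S"
    and triv: "U \<inter> {g. g permutes T} = {id}"
  shows "fact (card T) * card U \<le> fact (card S)"
proof -
  let ?Sym = "\<lambda>X. {g. g permutes X}"
  have fT: "finite T" using T S finite_subset by blast
  have "inj_on (\<lambda>(t, u). t \<circ> u) (?Sym T \<times> U)"
  proof (rule inj_onI, clarify)
    fix t t' u u' :: "'a \<Rightarrow> 'a"
    assume t: "t permutes T" "t' permutes T" and u: "u \<in> U" "u' \<in> U" and e: "t \<circ> u = t' \<circ> u'"
    note bu = perm_groupD(1)[OF U u(1)]
    have "inv t' \<circ> t \<circ> u = u'"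
      by (metis e fun.map_id o_assoc permutes_inv_o(2) t(2) id_comp)
    then have "inv t' \<circ> t = u' \<circ> inv u" by (metis bu comp_assoc comp_id permutes_inv_o(1))
    moreover have "u' \<circ> inv u \<in> U" using u perm_groupD[OF U] by blast
    moreover have "inv t' \<circ> t permutes T" using t by (simp add: permutes_compose permutes_inv)
    ultimately have *: "inv t' \<circ> t = id" "u' \<circ> inv u = id" using triv by auto
    have "t = t'" by (metis * comp_assoc comp_id id_comp permutes_inv_o(1) t(2))
    moreover have "u = u'" by (metis * bu comp_assoc comp_id id_comp permutes_inv_o(2))
    ultimately show "t = t' \<and> u = u'" by simp
  qed
  then have "card (?Sym T \<times> U) = card ((\<lambda>(t, u). t \<circ> u) ` (?Sym T \<times> U))"
    by (simp add: card_image)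
  also have "\<dots> \<le> card (?Sym S)"
    using finite_permutations[OF S]
    using permutes_compose[OF perm_groupD(1)[OF U] permutes_subset[OF _ T]]
    by (intro card_mono) auto
  finally show ?thesis using card_permutations[OF refl S] card_permutations[OF refl fT]
    by (simp add: card_cartesian_product)
qed

section \<open>3-cycles and alternating groups on subsets\<close>

definition cyc3 :: "'a \<Rightarrow> 'a \<Rightarrow> 'a \<Rightarrow> 'a \<Rightarrow> 'a" where
  "cyc3 a b c = (\<lambda>x. if x = a then b else if x = b then c else if x = c then a else x)"

text \<open>The 3-cycles on a finite set generate its alternating group, so for a group
  \<open>U\<close> this says that \<open>U\<close> contains the alternating group on
  \<open>Z\<close>. It is vacuous when \<open>Z\<close> has fewer than three points.\<close>

definition contains_alt :: "('a \<Rightarrow> 'a) set \<Rightarrow> 'a set \<Rightarrow> bool" where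
  "contains_alt U Z \<longleftrightarrow> (\<forall>a\<in>Z. \<forall>b\<in>Z. \<forall>c\<in>Z. distinct [a, b, c] \<longrightarrow> cyc3 a b c \<in> U)"

lemma contains_altD:
  "contains_alt U Z \<Longrightarrow> a \<in> Z \<Longrightarrow> b \<in> Z \<Longrightarrow> c \<in> Z \<Longrightarrow> a \<noteq> b \<Longrightarrow> a \<noteq> c \<Longrightarrow> b \<noteq> c \<Longrightarrow> cyc3 a b c \<in> U"
  by (auto simp: contains_alt_def)

lemma cyc3_eq_transpose:
  "distinct [a, b, c] \<Longrightarrow> cyc3 a b c = Transposition.transpose a b \<circ> Transposition.transpose b c"
  by (auto simp: fun_eq_iff cyc3_def Transposition.transpose_def)

lemma cyc3_permutes:
  assumes "distinct [a, b, c]" "{a, b, c} \<subseteq> S"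
  shows "cyc3 a b c permutes S"
  unfolding cyc3_eq_transpose[OF assms(1)]
  using assms(2) by (intro permutes_compose permutes_swap_id) auto

lemma inv_cyc3: "distinct [a, b, c] \<Longrightarrow> inv (cyc3 a b c) = cyc3 b a c"
  by (rule inv_unique_comp) (auto simp: cyc3_def fun_eq_iff)

lemma cyc3_conj:
  assumes "bij g"
  shows "g \<circ> cyc3 a b c \<circ> inv g = cyc3 (g a) (g b) (g c)"
proof
  fix x
  obtain y where x: "x = g y" using assms by (metis bij_pointE)
  then show "(g \<circ> cyc3 a b c \<circ> inv g) x = cyc3 (g a) (g b) (g c) x"
    using assms by (auto simp: cyc3_def bij_is_inj inj_eq)
qed

lemma cyc3_conj_in:
  assumes "perm_group S U" "g \<in> U" "cyc3 a b c \<in> U"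
  shows "cyc3 (g a) (g b) (g c) \<in> U"
  using assms cyc3_conj[of g a b c] perm_groupD[OF assms(1)] permutes_bij by metis

lemma contains_alt_image:
  assumes U: "perm_group S U" and g: "g \<in> U" and Z: "contains_alt U Z"
  shows "contains_alt U (g ` Z)"
  unfolding contains_alt_def
proof clarify
  fix a b c assume "a \<in> Z" "b \<in> Z" "c \<in> Z" "distinct [g a, g b, g c]"
  then show "cyc3 (g a) (g b) (g c) \<in> U"
    by (intro cyc3_conj_in[OF U g] contains_altD[OF Z]) auto
qed

text \<open>One 3-cycle through the new point \<open>c\<close> suffices: conjugating (x y c) by (x y
  z) gives (y z c), and inversion swaps the two old points, so all 3-cycles through \<open>c\<close>
  are reached.\<close>

lemma contains_alt_insert:
  assumes U: "perm_group S U" and Z: "contains_alt U Z"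
    and ab: "a \<in> Z" "b \<in> Z" "a \<noteq> b" and c: "c \<notin> Z" and abc: "cyc3 a b c \<in> U"
  shows "contains_alt U (insert c Z)"
proof -
  have sym: "cyc3 y x c \<in> U" if "cyc3 x y c \<in> U" "x \<in> Z" "y \<in> Z" "x \<noteq> y" for x y
  proof -
    have "distinct [x, y, c]" using that c by auto
    then show ?thesis using perm_groupD(4)[OF U that(1)] inv_cyc3 by metis
  qed
  have step: "cyc3 y z c \<in> U" if "cyc3 x y c \<in> U" "x \<in> Z" "y \<in> Z" "x \<noteq> y" "z \<in> Z" "z \<noteq> x" "z \<noteq> y"
    for x y z
  proof -
    have "c \<noteq> x" "c \<noteq> y" "c \<noteq> z" using that c by auto
    then have "cyc3 x y z x = y" "cyc3 x y z y = z" "cyc3 x y z c = c"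
      using that by (simp_all add: cyc3_def)
    then show ?thesis using cyc3_conj_in[OF U contains_altD[OF Z, of x y z] that(1)] that by simp
  qed
  have b: "cyc3 b y c \<in> U" if "y \<in> Z" "y \<noteq> b" for y
    using sym[OF abc ab(1,2,3)] step[OF abc ab] that by metis
  have key: "cyc3 x y c \<in> U" if "x \<in> Z" "y \<in> Z" "x \<noteq> y" for x y
    using b[of x] b[of y] sym[of b x] step[of b x y] that ab by metis
  show ?thesis
    unfolding contains_alt_def
  proof (intro ballI impI)
    fix x y z assume xyz: "x \<in> insert c Z" "y \<in> insert c Z" "z \<in> insert c Z" and d: "distinct [x, y, z]"
    have r: "cyc3 x y z = cyc3 y z x" "cyc3 x y z = cyc3 z x y" using d by (auto simp: cyc3_def fun_eq_iff)
    consider "x = c" | "y = c" | "z = c" | "x \<in> Z" "y \<in> Z" "z \<in> Z" using xyz by blast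
    then show "cyc3 x y z \<in> U"
    proof cases
      case 1 then show ?thesis using key[of y z] r d xyz by auto
    next
      case 2 then show ?thesis using key[of z x] r d xyz by auto
    next
      case 3 then show ?thesis using key[of x y] d xyz by auto
    next
      case 4 then show ?thesis using contains_altD[OF Z] d by auto
    qed
  qed
qed

text \<open>If \<open>Y\<close> and \<open>Z\<close> share a second point \<open>y\<close>, then (x
  y c) is a 3-cycle on \<open>Y\<close>. If they share only \<open>x\<close>, conjugating (x c d) by
  (x y z) gives (y c d), and the product of (x c d) with its inverse is (y x c).\<close>

lemma contains_alt_extend:
  assumes U: "perm_group S U" and Z: "contains_alt U Z" "contains_alt U Y"
    and card: "3 \<le> card Z" "3 \<le> card Y" and meet: "x \<in> Z" "x \<in> Y" and nsub: "c \<in> Y" "c \<notin> Z"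
  shows "contains_alt U (insert c Z)"
proof (cases "\<exists>y\<in>Y \<inter> Z. y \<noteq> x")
  case True
  then obtain y where y: "y \<in> Y" "y \<in> Z" "y \<noteq> x" by blast
  then have "cyc3 x y c \<in> U" using contains_altD[OF Z(2)] meet nsub by metis
  then show ?thesis using contains_alt_insert[OF U Z(1)] meet y nsub by metis
next
  case False
  have "\<not> Y \<subseteq> {x, c}"
  proof
    assume "Y \<subseteq> {x, c}"
    then have "card Y \<le> card {x, c}" by (intro card_mono) auto
    also have "\<dots> \<le> 2" by (simp add: card_insert_le_m1)
    finally show False using card by simp
  qed
  then obtain d where d: "d \<in> Y" "d \<noteq> x" "d \<noteq> c" by blast
  have "\<not> Z \<subseteq> {x}"
  proof
    assume "Z \<subseteq> {x}"
    then have "card Z \<le> card {x}" by (intro card_mono) auto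
    then show False using card by simp
  qed
  then obtain y where y: "y \<in> Z" "y \<noteq> x" by blast
  have "\<not> Z \<subseteq> {x, y}"
  proof
    assume "Z \<subseteq> {x, y}"
    then have "card Z \<le> card {x, y}" by (intro card_mono) auto
    also have "\<dots> \<le> 2" by (simp add: card_insert_le_m1)
    finally show False using card by simp
  qed
  then obtain z where z: "z \<in> Z" "z \<noteq> x" "z \<noteq> y" by blast
  have dn: "d \<notin> Z" "y \<notin> Y" "z \<notin> Y" using False d y z by auto
  have xcd: "cyc3 x c d \<in> U" using contains_altD[OF Z(2)] meet nsub d by metis
  have xyz: "cyc3 x y z \<in> U" using contains_altD[OF Z(1)] meet y z by metis
  have "cyc3 y c d \<in> U"
  proof -
    have "c \<noteq> x" "c \<noteq> y" "c \<noteq> z" "d \<noteq> y" "d \<noteq> z" using nsub meet dn y z d by auto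
    then have "cyc3 x y z x = y" "cyc3 x y z c = c" "cyc3 x y z d = d"
      using d by (simp_all add: cyc3_def)
    then show ?thesis using cyc3_conj_in[OF U xyz xcd] by simp
  qed
  moreover have "inv (cyc3 y c d) = cyc3 c y d" using dn nsub d y by (intro inv_cyc3) auto
  ultimately have "cyc3 x c d \<circ> cyc3 c y d \<in> U" using perm_groupD[OF U] xcd by metis
  moreover have "cyc3 x c d \<circ> cyc3 c y d = cyc3 y x c"
    using dn nsub meet d y z by (auto simp: cyc3_def fun_eq_iff)
  ultimately show ?thesis using contains_alt_insert[OF U Z(1) y(1) meet(1) y(2) nsub(2)] by simp
qed

text \<open>Away from \<open>a\<close> and its preimages under \<open>x\<close> and
  \<open>y\<close>, the two permutations commute, because their supports meet only in
  \<open>a\<close>. The three exceptional points account for the 3-cycle.\<close>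

lemma commutator_cyc3:
  assumes x: "bij x" and y: "bij y" and ax: "x a \<noteq> a" and ay: "y a \<noteq> a"
    and supp: "\<And>b. b \<noteq> a \<Longrightarrow> x b = b \<or> y b = b"
  shows "x \<circ> y \<circ> inv x \<circ> inv y = cyc3 a (x a) (y a)"
proof -
  have jx: "x b = x c \<longleftrightarrow> b = c" and jy: "y b = y c \<longleftrightarrow> b = c" for b c
    using x y by (auto simp: bij_is_inj inj_eq)
  \<comment> \<open>The claim is checked pointwise in the inverse-free form
    \<open>x \<circ> y = cyc3 a (x a) (y a) \<circ> y \<circ> x\<close>. Cases 1 to 3 are
    \<open>a\<close> and its two preimages.\<close>
  have "x (y b) = cyc3 a (x a) (y a) (y (x b))" for b
  proof -
    consider "b = a" | "b \<noteq> a" "x b = a" | "b \<noteq> a" "x b \<noteq> a" "x b = b" "y b = a"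
      | "b \<noteq> a" "x b \<noteq> a" "x b = b" "y b \<noteq> a" | "b \<noteq> a" "x b \<noteq> a" "x b \<noteq> b" by blast
    then show ?thesis
    proof cases
      case 1
      moreover have "y (x a) = x a" using supp[OF ax] jx ax by auto
      moreover have "x (y a) = y a" using supp[OF ay] jy ay by auto
      ultimately show ?thesis using ax by (auto simp: cyc3_def)
    next
      case 2
      then have "y b = b" using supp[of b] by auto
      moreover have "x a \<noteq> y a" using supp[OF ax] jx jy ax 2 by metis
      ultimately show ?thesis using 2 ay by (auto simp: cyc3_def)
    next
      case 3
      then show ?thesis by (auto simp: cyc3_def)
    next
      case 4
      have "x (y b) = y b" using supp[OF 4(4)] jy 4 by metis
      moreover have "y b \<noteq> y a" using jy 4 by simp
      moreover have "y b \<noteq> x a"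
      proof
        assume e: "y b = x a"
        then have "y b = b" using supp[OF ax] jx jy ax by metis
        then show False using e 4 jx by metis
      qed
      ultimately show ?thesis using 4 by (simp add: cyc3_def)
    next
      case 5
      then have "y b = b" using supp by blast
      moreover have "y (x b) = x b" using supp[OF 5(2)] jx 5 by metis
      moreover have "x b \<noteq> x a" using jx 5 by simp
      moreover have "x b \<noteq> y a"
      proof
        assume "x b = y a"
        then have "x b = a" using jy \<open>y (x b) = x b\<close> by metis
        then show False using 5 by simp
      qed
      ultimately show ?thesis using 5 by (simp add: cyc3_def)
    qed
  qed
  then have "x \<circ> y = cyc3 a (x a) (y a) \<circ> y \<circ> x" by (simp add: fun_eq_iff)
  moreover have "x \<circ> inv x = id" "y \<circ> inv y = id"
    using x y by (simp_all add: bij_is_surj surj_iff[symmetric])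
  ultimately show ?thesis by (metis comp_assoc comp_id)
qed

text \<open>
  Bochert's argument: if \<open>T\<close> is a maximal set that supports no nontrivial element of \<open>U\<close> and
  \<open>2 |T| < |S|\<close>, then some \<open>y \<in> U\<close> supported on \<open>S - T\<close> and some \<open>x \<in> U\<close> supported on
  \<open>T \<union> {a}\<close> share exactly the point \<open>a\<close> of their supports, so their commutator is a 3-cycle.
\<close>

lemma exists_cyc3_or_large_trivial_subset:
  assumes U: "perm_group S U" and S: "finite S"
    and no: "\<And>a b c. distinct [a, b, c] \<Longrightarrow> cyc3 a b c \<notin> U"
  shows "\<exists>T\<subseteq>S. U \<inter> {g. g permutes T} = {id} \<and> card S \<le> 2 * card T"
proof -
  define P where "P T \<longleftrightarrow> T \<subseteq> S \<and> U \<inter> {g. g permutes T} = {id}" for T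
  have "P {}" using perm_groupD(2)[OF U] by (auto simp: P_def)
  moreover have "\<forall>T. P T \<longrightarrow> card T < Suc (card S)"
    using S card_mono by (auto simp: P_def less_Suc_eq_le)
  ultimately obtain T where T: "P T" and max: "\<And>T'. P T' \<Longrightarrow> card T' \<le> card T"
    using ex_has_greatest_nat[of P "{}" card "Suc (card S)"] by blast
  have TS: "T \<subseteq> S" and triv: "U \<inter> {g. g permutes T} = {id}" using T by (auto simp: P_def)
  have fT: "finite T" using TS S finite_subset by blast
  have "card S \<le> 2 * card T"
  proof (rule ccontr)
    assume "\<not> card S \<le> 2 * card T"
    then have "card T < card (S - T)" using TS S fT by (simp add: card_Diff_subset)
    then have "\<not> P (S - T)" using max leD by blast
    then obtain y where y: "y \<in> U" "y permutes (S - T)" "y \<noteq> id"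
      using perm_groupD(2)[OF U] unfolding P_def by auto
    then obtain a where a: "y a \<noteq> a" by fastforce
    then have aS: "a \<in> S" "a \<notin> T" using y(2) by (auto simp: permutes_def)
    then have "\<not> P (insert a T)" using max[of "insert a T"] fT by auto
    then obtain x where x: "x \<in> U" "x permutes (insert a T)" "x \<noteq> id"
      using perm_groupD(2)[OF U] TS aS unfolding P_def by auto
    have xa: "x a \<noteq> a"
    proof
      assume "x a = a"
      then have "x permutes T" using permutes_superset[OF x(2), of T] by auto
      then show False using triv x by blast
    qed
    have supp: "x b = b \<or> y b = b" if "b \<noteq> a" for b
      using that x(2) y(2) by (auto simp: permutes_def)
    have "x \<circ> y \<circ> inv x \<circ> inv y = cyc3 a (x a) (y a)"
      using commutator_cyc3[OF _ _ xa a supp] x y permutes_bij by metis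
    moreover have "x \<circ> y \<circ> inv x \<circ> inv y \<in> U"
      using x(1) y(1) perm_groupD(3,4)[OF U] by simp
    \<comment> \<open>A common image would be a point other than \<open>a\<close> that both
      \<open>x\<close> and \<open>y\<close> move.\<close>
    moreover have "x a \<noteq> y a"
    proof
      assume e: "x a = y a"
      have "x (x a) \<noteq> x a" using xa permutes_inj[OF x(2)] by (simp add: inj_eq)
      moreover have "y (y a) \<noteq> y a" using a permutes_inj[OF y(2)] by (simp add: inj_eq)
      ultimately show False using supp[OF xa] e by metis
    qed
    ultimately show False using no[of a "x a" "y a"] xa a by auto
  qed
  then show ?thesis using TS triv by blast
qed

section \<open>Estimates for binomial coefficients and factorials\<close>

text \<open>With m = n - 1, Pascal's rule bounds the left side strictly by 2 (m choose k), and the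
  ratio (m - k) / (k + 1) of consecutive coefficients is at least 2. This limits the size of a block
  to k + 1.\<close>

lemma binomial_less_binomial_pred_Suc:
  assumes "4 * k + 2 \<le> n" "1 \<le> k"
  shows "n choose k < (n - 1) choose Suc k"
proof -
  obtain m where n: "n = Suc m" using assms by (cases n) auto
  obtain r where k: "k = Suc r" using assms by (cases k) auto
  have "n choose k = (m choose k) + (m choose r)" using n k by simp
  moreover have "m choose r < m choose k"
    using assms n k by (intro binomial_strict_mono) auto
  moreover have "2 * (m choose k) \<le> m choose Suc k"
  proof -
    have "Suc k * (m choose Suc k) = (m - k) * (m choose k)"
      by (metis binomial_absorb_comp binomial_absorption diff_Suc_1 mult.commute n)
    moreover have "Suc k * (2 * (m choose k)) \<le> (m - k) * (m choose k)"
      using assms n unfolding mult.assoc[symmetric] by (intro mult_right_mono) auto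
    ultimately show ?thesis by (metis mult_le_cancel1 zero_less_Suc)
  qed
  ultimately show ?thesis using n by simp
qed

lemma four_power_le_fact: "9 \<le> h \<Longrightarrow> 4 ^ h \<le> (fact h :: nat)"
proof (induction h rule: dec_induct)
  case base
  show ?case by (simp add: fact_numeral)
next
  case (step h)
  then have "4 * 4 ^ h \<le> Suc h * (fact h :: nat)" by (intro mult_mono) auto
  then show ?case by simp
qed

text \<open>With h = (n + 1) div 2, the chain 2^n \<le> 4^h \<le> h! works from h = 9 on; the
  remaining pairs (n, k) are checked with the bound n^k. For n = 6, k = 1 both sides equal 6, hence
  the exception.\<close>

lemma binomial_less_fact_half:
  assumes "4 * k + 2 \<le> n" "1 \<le> k" "\<not> (n = 6 \<and> k = 1)"
  shows "n choose k < fact ((n + 1) div 2)"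
proof (cases "9 \<le> (n + 1) div 2")
  case True
  have "n choose k < 2 ^ n"
    using binomial_strict_mono[of k "Suc k" n] binomial_le_pow2[of n "Suc k"] assms by simp
  also have "\<dots> \<le> (2::nat) ^ (2 * ((n + 1) div 2))" by (intro power_increasing) auto
  also have "\<dots> = 4 ^ ((n + 1) div 2)" by (simp add: power_mult)
  also have "\<dots> \<le> fact ((n + 1) div 2)" by (rule four_power_le_fact[OF True])
  finally show ?thesis .
next
  case False
  then have "n \<le> 16" by simp
  then have "n = 6 \<or> n = 7 \<or> n = 8 \<or> n = 9 \<or> n = 10 \<or> n = 11 \<or> n = 12 \<or> n = 13
      \<or> n = 14 \<or> n = 15 \<or> n = 16" "k = 1 \<or> k = 2 \<or> k = 3"
    using assms by presburger+
  then have "n ^ k < fact ((n + 1) div 2)" using assms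
    by (auto simp: fact_numeral)
  moreover have "n choose k \<le> n ^ k" using assms by (intro binomial_le_pow) simp
  ultimately show ?thesis by linarith
qed

section \<open>Induction on the number of points\<close>

lemma contains_alt_mono: "contains_alt U Z \<Longrightarrow> U \<subseteq> V \<Longrightarrow> contains_alt V Z"
  by (auto simp: contains_alt_def)

lemma contains_alt_triple:
  assumes U: "perm_group S U" and d: "distinct [a, b, c]" and abc: "cyc3 a b c \<in> U"
  shows "contains_alt U {a, b, c}"
proof -
  have "inv (cyc3 a b c) \<in> U" using U abc by (rule perm_groupD(4))
  then have "cyc3 b a c \<in> U" using inv_cyc3[OF d] by simp
  moreover have "cyc3 b c a = cyc3 a b c" "cyc3 c a b = cyc3 a b c"
    "cyc3 a c b = cyc3 b a c" "cyc3 c b a = cyc3 b a c"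
    using d by (auto simp: cyc3_def fun_eq_iff)
  ultimately show ?thesis using abc by (auto simp: contains_alt_def)
qed

text \<open>With n = |S|, j = |J| and u the number of elements of \<open>U\<close> supported off
  \<open>J\<close>, counting gives (n - j)! (n choose j) \<le> (n choose k) u. The trivial bound u
  \<le> (n - j)! yields j \<le> k. The second claim passes the index bound on to S - J with k - j in
  place of k.\<close>

lemma invariant_subset_small:
  assumes U: "perm_group S U" and S: "finite S" and J: "J \<subseteq> S" "2 * card J \<le> card S"
    and inv: "\<And>g. g \<in> U \<Longrightarrow> g ` J \<subseteq> J" and k: "2 * k \<le> card S"
    and index: "fact (card S) \<le> (card S choose k) * card U"
  shows "card J \<le> k"
    and "fact (card S - card J)
      \<le> (card S - card J choose (k - card J)) * card (U \<inter> {g. g permutes (S - J)})"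
proof -
  let ?n = "card S" and ?j = "card J" and ?u = "card (U \<inter> {g. g permutes (S - J)})"
  have "card U \<le> fact ?j * ?u"
    using card_le_fact_times_pointwise_stabilizer[OF U S J(1) inv] .
  then have "fact ?n \<le> (?n choose k) * (fact ?j * ?u)" using index by (meson le_trans mult_le_mono2)
  moreover have "fact ?n = fact ?j * fact (?n - ?j) * (?n choose ?j)"
    using binomial_fact_lemma[of ?j ?n] J by simp
  ultimately have "fact ?j * (fact (?n - ?j) * (?n choose ?j)) \<le> fact ?j * ((?n choose k) * ?u)"
    by (simp add: algebra_simps)
  then have 1: "fact (?n - ?j) * (?n choose ?j) \<le> (?n choose k) * ?u" by simp
  have u: "?u \<le> fact (?n - ?j)"
    using perm_group_card_le[OF perm_group_Int_Sym[OF U, of "S - J"]] S J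
    by (simp add: card_Diff_subset finite_subset)
  note 1
  also have "(?n choose k) * ?u \<le> (?n choose k) * fact (?n - ?j)"
    using u by (rule mult_le_mono2)
  also have "\<dots> = fact (?n - ?j) * (?n choose k)" by (rule mult.commute)
  finally have "fact (?n - ?j) * (?n choose ?j) \<le> fact (?n - ?j) * (?n choose k)" .
  then have "?n choose ?j \<le> ?n choose k" by simp
  then show jk: "?j \<le> k"
    using binomial_strict_mono[OF _ J(2), of k] by (meson not_le)
  \<comment> \<open>A factor k choose j, at least 1, is inserted so that (n choose k) (k choose j) =
    (n choose j) (n - j choose k - j) applies.\<close>
  have "(?n choose k) * 1 * ?u \<le> (?n choose k) * (k choose ?j) * ?u"
    using jk by (intro mult_le_mono1 mult_le_mono2) (simp add: Suc_leI)
  also have "(?n choose k) * (k choose ?j) = (?n choose ?j) * (?n - ?j choose (k - ?j))"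
    using jk k by (intro choose_mult) auto
  finally have "(?n choose k) * ?u \<le> (?n choose ?j) * (?n - ?j choose (k - ?j)) * ?u" by simp
  from order_trans[OF 1 this]
  have "(?n choose ?j) * fact (?n - ?j) \<le> (?n choose ?j) * ((?n - ?j choose (k - ?j)) * ?u)"
    by (simp only: mult_ac)
  moreover have "0 < ?n choose ?j" using J by simp
  ultimately show "fact (?n - ?j) \<le> (?n - ?j choose (k - ?j)) * ?u"
    using mult_le_cancel1 by blast
qed

text \<open>
  The largest set \<open>Z\<close> on which \<open>U\<close> contains the alternating group is a block of \<open>U\<close>. If it were not
  all of \<open>S\<close>, then \<open>|Z| \<le> k + 1\<close> by the index bound, and the induction hypothesis for \<open>S - Z\<close> with
  \<open>k + 2 - |Z|\<close> would produce a larger such set.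
\<close>

lemma transitive_small_index:
  assumes S: "finite S" and U: "perm_group S U"
    and trans: "\<And>a b. a \<in> S \<Longrightarrow> b \<in> S \<Longrightarrow> \<exists>g\<in>U. g a = b"
    and n: "4 * k + 2 \<le> card S" "1 \<le> k" "\<not> (card S = 6 \<and> k = 1)"
    and index: "fact (card S) \<le> (card S choose k) * card U"
    and IH: "\<And>T r. T \<subset> S \<Longrightarrow> 4 * r + 2 \<le> card T \<Longrightarrow> \<not> (card T = 6 \<and> r = 1) \<Longrightarrow>
      fact (card T) \<le> (card T choose r) * card (U \<inter> {g. g permutes T}) \<Longrightarrow>
      \<exists>Z\<subseteq>T. card T \<le> card Z + r \<and> contains_alt (U \<inter> {g. g permutes T}) Z"
  shows "contains_alt U S"
proof -
  let ?n = "card S"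
  have "\<exists>a b c. distinct [a, b, c] \<and> cyc3 a b c \<in> U"
  proof (rule ccontr)
    assume "\<not> ?thesis"
    then have no: "\<And>a b c. distinct [a, b, c] \<Longrightarrow> cyc3 a b c \<notin> U" by blast
    \<comment> \<open>\<open>T\<close> contains at least half of the points, and the symmetric group
      on it meets \<open>U\<close> trivially, so the index of \<open>U\<close> would be at least
      |T|!, which exceeds n choose k.\<close>
    obtain T where T: "T \<subseteq> S" "U \<inter> {g. g permutes T} = {id}" "?n \<le> 2 * card T"
      using exists_cyc3_or_large_trivial_subset[OF U S no] by blast
    have "fact (card T) * card U \<le> (?n choose k) * card U"
      using fact_mult_card_le[OF U S T(1,2)] index by linarith
    then have "fact (card T) \<le> ?n choose k" using perm_group_card_pos[OF U S] by simp
    moreover have "fact ((?n + 1) div 2) \<le> (fact (card T) :: nat)"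
      using T(3) by (intro fact_mono) simp
    ultimately show False using binomial_less_fact_half[OF n] by linarith
  qed
  then obtain a b c where abc: "distinct [a, b, c]" "cyc3 a b c \<in> U" by blast
  define P where "P Z \<longleftrightarrow> Z \<subseteq> S \<and> 3 \<le> card Z \<and> contains_alt U Z" for Z
  have "a \<in> S" "b \<in> S" "c \<in> S"
    using perm_groupD(1)[OF U abc(2)] abc(1) by (auto simp: permutes_def cyc3_def)
  then have "P {a, b, c}" using contains_alt_triple[OF U abc] abc(1) by (auto simp: P_def)
  moreover have "\<forall>Z. P Z \<longrightarrow> card Z < Suc ?n"
    using S card_mono by (auto simp: P_def less_Suc_eq_le)
  ultimately obtain Z where Z: "P Z" and max: "\<And>Z'. P Z' \<Longrightarrow> card Z' \<le> card Z"
    using ex_has_greatest_nat[of P "{a, b, c}" card "Suc ?n"] by blast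
  let ?b = "card Z"
  have ZS: "Z \<subseteq> S" and Z3: "3 \<le> ?b" and altZ: "contains_alt U Z" using Z by (auto simp: P_def)
  have fZ: "finite Z" using ZS S finite_subset by blast
  \<comment> \<open>A translate that meets \<open>Z\<close> but leaves it would enlarge
    \<open>Z\<close> by one point, against maximality.\<close>
  have block: "g ` Z \<subseteq> Z" if g: "g \<in> U" and x: "x \<in> Z" "x \<in> g ` Z" for g x
  proof
    fix c assume c: "c \<in> g ` Z"
    show "c \<in> Z"
    proof (rule ccontr)
      assume nc: "c \<notin> Z"
      have gS: "g permutes S" using U g by (rule perm_groupD)
      have "card (g ` Z) = card Z" using gS by (meson card_image permutes_inj_on)
      then have "contains_alt U (insert c Z)"
        using contains_alt_extend[OF U altZ contains_alt_image[OF U g altZ] Z3 _ x c nc] Z3 by simp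
      moreover have "c \<in> S" using c ZS permutes_image[OF gS] by blast
      ultimately have "P (insert c Z)" using ZS Z3 nc fZ by (auto simp: P_def)
      then show False using max[of "insert c Z"] nc fZ by simp
    qed
  qed
  show ?thesis
  proof (rule ccontr)
    assume "\<not> contains_alt U S"
    then have "Z \<noteq> S" using altZ by blast
    then obtain y where y: "y \<in> S" "y \<notin> Z" using ZS by blast
    obtain x where x: "x \<in> Z" using Z3 by fastforce
    \<comment> \<open>Transitivity provides a translate of the block disjoint from it, so
      \<open>Z\<close> has at most half of the points.\<close>
    obtain g where g: "g \<in> U" "g x = y" using trans[of x y] x y ZS by blast
    have gS: "g permutes S" using U g(1) by (rule perm_groupD)
    have "g ` Z \<inter> Z = {}" using block[OF g(1)] x y g(2) by blast
    moreover have "g ` Z \<subseteq> S" using ZS permutes_image[OF gS] by blast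
    moreover have "card (g ` Z) = ?b" using gS by (meson card_image permutes_inj_on)
    ultimately have b2: "2 * ?b \<le> ?n"
      using card_Un_disjoint[of "g ` Z" Z] card_mono[of S "g ` Z \<union> Z"] S fZ ZS by simp
    \<comment> \<open>The bound |U| \<le> n (b - 1)! u, with b = |Z|, comes from the orbit of
      \<open>x\<close>, the action of its stabilizer on Z - {x}, and the u elements that fix
      \<open>Z\<close> pointwise.\<close>
    let ?Ux = "{g \<in> U. g x = x}" and ?u = "card (U \<inter> {g. g permutes (S - Z)})"
    have Ux: "perm_group S ?Ux" using U by (rule perm_group_stabilizer)
    have "card U \<le> card ((\<lambda>g. g x) ` U) * card ?Ux"
    proof (rule card_le_image_times_card[OF U _ S])
      show "finite ?Ux" using perm_group_finite[OF Ux S] .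
      show "inv g \<circ> h \<in> ?Ux" if "g \<in> U" "h \<in> U" "g x = h x" for g h
        using that perm_groupD[OF U] permutes_inverses(2)[of g S x] by auto
    qed
    moreover have "card ((\<lambda>g. g x) ` U) \<le> ?n"
      using perm_groupD(1)[OF U] x ZS S permutes_in_image by (intro card_mono) fastforce+
    moreover have "card ?Ux \<le> fact (?b - 1) * ?u"
    proof -
      have "g ` (Z - {x}) \<subseteq> Z - {x}" if "g \<in> ?Ux" for g
      proof -
        have "g permutes S" "g ` Z \<subseteq> Z" using that perm_groupD(1)[OF U] block[of g x] x by force+
        moreover have "g x = x" using that by simp
        ultimately show ?thesis using permutes_inj[of g S] by (auto simp: inj_def)
      qed
      then have "card ?Ux \<le> fact (card (Z - {x})) * card (?Ux \<inter> {g. g permutes (S - (Z - {x}))})"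
        using ZS by (intro card_le_fact_times_pointwise_stabilizer[OF Ux S]) auto
      also have "card (Z - {x}) = ?b - 1" using x fZ by simp
      also have "card (?Ux \<inter> {g. g permutes (S - (Z - {x}))}) \<le> ?u"
      proof (rule card_mono)
        show "finite (U \<inter> {g. g permutes (S - Z)})" using perm_group_finite[OF U S] by blast
        show "?Ux \<inter> {g. g permutes (S - (Z - {x}))} \<subseteq> U \<inter> {g. g permutes (S - Z)}"
          by (auto intro: permutes_superset)
      qed
      finally show ?thesis by simp
    qed
    ultimately have "card U \<le> ?n * (fact (?b - 1) * ?u)" by (meson le_trans mult_le_mono)
    then have "fact ?n \<le> (?n choose k) * (?n * (fact (?b - 1) * ?u))"
      using index by (meson le_trans mult_le_mono2)
    moreover have "fact ?n = ?n * (fact (?b - 1) * fact (?n - ?b) * ((?n - 1) choose (?b - 1)))"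
      using binomial_fact_lemma[of "?b - 1" "?n - 1"] b2 Z3 fact_reduce[of ?n, where 'a = nat] by simp
    ultimately have "(?n * fact (?b - 1)) * (((?n - 1) choose (?b - 1)) * fact (?n - ?b))
        \<le> (?n * fact (?b - 1)) * ((?n choose k) * ?u)"
      by (simp only: mult_ac)
    moreover have "0 < ?n * fact (?b - 1)" using n by simp
    ultimately have 1: "((?n - 1) choose (?b - 1)) * fact (?n - ?b) \<le> (?n choose k) * ?u"
      using mult_le_cancel1 by blast
    have cSZ: "card (S - Z) = ?n - ?b" using fZ ZS by (simp add: card_Diff_subset)
    have "?u \<le> fact (?n - ?b)"
      using perm_group_card_le[OF perm_group_Int_Sym[OF U, of "S - Z"]] S cSZ by simp
    then have "((?n - 1) choose (?b - 1)) * fact (?n - ?b) \<le> (?n choose k) * fact (?n - ?b)"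
      using 1 by (meson le_trans mult_le_mono2)
    then have 2: "(?n - 1) choose (?b - 1) \<le> ?n choose k" by simp
    note 3 = binomial_less_binomial_pred_Suc[OF n(1,2)]
    have bk: "?b \<le> k + 1"
    proof (rule ccontr)
      assume "\<not> ?b \<le> k + 1"
      then have "(?n - 1) choose Suc k \<le> (?n - 1) choose (?b - 1)"
        using b2 by (intro binomial_mono) auto
      then show False using 2 3 by linarith
    qed
    have k2: "2 \<le> k" using bk Z3 by simp
    \<comment> \<open>This is (k + 1) - (b - 1): choosing k + 1 points and then b - 1 of them
      converts the bound by n - 1 choose k + 1 into an index bound for S - Z with parameter
      r.\<close>
    let ?r = "k + 2 - ?b"
    have "?n choose k \<le> ((?n - 1) choose Suc k) * (Suc k choose (?b - 1))"
    proof -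
      have "((?n - 1) choose Suc k) * 1 \<le> ((?n - 1) choose Suc k) * (Suc k choose (?b - 1))"
        using bk by (intro mult_le_mono2) (simp add: Suc_leI)
      then show ?thesis using 3 by linarith
    qed
    also have "\<dots> = ((?n - 1) choose (?b - 1)) * ((?n - 1 - (?b - 1)) choose (Suc k - (?b - 1)))"
      using bk n by (intro choose_mult) auto
    also have "?n - 1 - (?b - 1) = ?n - ?b" using Z3 b2 by simp
    also have "Suc k - (?b - 1) = ?r" using Z3 bk by simp
    finally have "((?n - 1) choose (?b - 1)) * fact (?n - ?b)
        \<le> ((?n - 1) choose (?b - 1)) * ((?n - ?b) choose ?r) * ?u"
      using 1 by (meson le_trans mult_le_mono1)
    moreover have "0 < (?n - 1) choose (?b - 1)" using b2 by simp
    ultimately have 4: "fact (?n - ?b) \<le> ((?n - ?b) choose ?r) * ?u"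
      using mult_le_cancel1 mult.assoc by metis
    have "\<exists>Z'\<subseteq>S - Z. card (S - Z) \<le> card Z' + ?r \<and> contains_alt (U \<inter> {g. g permutes (S - Z)}) Z'"
    proof (rule IH)
      show "S - Z \<subset> S" using ZS x by blast
      show "4 * ?r + 2 \<le> card (S - Z)" using n bk Z3 cSZ by simp
      show "\<not> (card (S - Z) = 6 \<and> ?r = 1)" using n bk k2 cSZ by simp
      show "fact (card (S - Z)) \<le> (card (S - Z) choose ?r) * ?u" unfolding cSZ by (rule 4)
    qed
    then obtain Z' where Z': "Z' \<subseteq> S - Z" "?n - ?b \<le> card Z' + ?r"
      "contains_alt (U \<inter> {g. g permutes (S - Z)}) Z'"
      unfolding cSZ by blast
    \<comment> \<open>Indeed |Z'| \<ge> n - b - r = n - k - 2 \<ge> 3k, which is larger than k + 1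
      \<ge> |Z| because k \<ge> 2.\<close>
    have "3 \<le> card Z'" using Z'(2) bk n k2 by simp
    then have "P Z'" using Z' contains_alt_mono[OF Z'(3), of U] by (auto simp: P_def)
    then show False using max[of Z'] Z'(2) bk n k2 by simp
  qed
qed

text \<open>
  The exception is genuine: the symmetric group on 6 points has transitive subgroups of index 6
  without 3-cycles.
\<close>

theorem small_index_contains_alt:
  assumes "finite S" "perm_group S U" "4 * k + 2 \<le> card S" "\<not> (card S = 6 \<and> k = 1)"
    and "fact (card S) \<le> (card S choose k) * card U"
  shows "\<exists>Z\<subseteq>S. card S \<le> card Z + k \<and> contains_alt U Z"
  using assms
proof (induction "card S" arbitrary: S U k rule: less_induct)
  case less
  note S = less.prems(1) and U = less.prems(2) and n = less.prems(3,4) and index = less.prems(5)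
  show ?case
  proof (cases "k = 0")
    case True
    \<comment> \<open>For k = 0 the index bound is 1.\<close>
    have "U = {g. g permutes S}"
      using perm_group_subset[OF U] index True finite_permutations[OF S] card_permutations[OF refl S]
      by (intro card_seteq) auto
    then have "contains_alt U S" by (auto simp: contains_alt_def intro!: cyc3_permutes)
    then show ?thesis by auto
  next
    case False
    then have k1: "1 \<le> k" by simp
    show ?thesis
    proof (cases "\<forall>a\<in>S. \<forall>b\<in>S. \<exists>g\<in>U. g a = b")
      case True
      have "contains_alt U S"
      proof (rule transitive_small_index[OF S U _ n(1) k1 n(2) index])
        show "\<exists>g\<in>U. g a = b" if "a \<in> S" "b \<in> S" for a b using True that by blast
      next
        fix T r
        assume T: "T \<subset> S" "4 * r + 2 \<le> card T" "\<not> (card T = 6 \<and> r = 1)"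
          "fact (card T) \<le> (card T choose r) * card (U \<inter> {g. g permutes T})"
        then show "\<exists>Z\<subseteq>T. card T \<le> card Z + r \<and> contains_alt (U \<inter> {g. g permutes T}) Z"
          using less.hyps[of T "U \<inter> {g. g permutes T}" r] perm_group_Int_Sym[OF U, of T]
            psubset_card_mono[OF S T(1)] finite_subset[of T S] S by blast
      qed
      then show ?thesis by auto
    next
      case False
      then obtain a b where 3: "a \<in> S" "b \<in> S" "\<And>g. g \<in> U \<Longrightarrow> g a \<noteq> b" by blast
      define O1 where "O1 = (\<lambda>g. g a) ` U"
      have O1: "O1 \<subseteq> S" using perm_groupD(1)[OF U] 3 permutes_in_image by (fastforce simp: O1_def)
      have inv1: "g ` O1 \<subseteq> O1" if "g \<in> U" for g
      proof (clarsimp simp: O1_def)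
        fix h assume "h \<in> U"
        then have "g \<circ> h \<in> U" using perm_groupD(3)[OF U that] by blast
        then show "g (h a) \<in> (\<lambda>g. g a) ` U" by (metis comp_apply imageI)
      qed
      have inv2: "g ` (S - O1) \<subseteq> S - O1" if "g \<in> U" for g
      proof clarify
        fix x assume x: "x \<in> S" "x \<notin> O1"
        have gS: "g permutes S" using U that by (rule perm_groupD)
        have "g x \<notin> O1"
        proof
          assume "g x \<in> O1"
          then have "inv g (g x) \<in> O1" using inv1[OF perm_groupD(4)[OF U that]] by blast
          then show False using x permutes_inverses(2)[OF gS] by simp
        qed
        then show "g x \<in> S - O1" using x permutes_in_image[OF gS] by auto
      qed
      have ne: "O1 \<noteq> {}" "S - O1 \<noteq> {}"
        using perm_groupD(2)[OF U] 3 by (auto simp: O1_def)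
      have "card (S - O1) = card S - card O1" using O1 S by (simp add: card_Diff_subset finite_subset)
      \<comment> \<open>\<open>J\<close> is the smaller one of an orbit and its complement.\<close>
      then obtain J where J: "J \<subseteq> S" "J \<noteq> {}" "2 * card J \<le> card S" "\<And>g. g \<in> U \<Longrightarrow> g ` J \<subseteq> J"
        using O1 ne inv1 inv2 that[of O1] that[of "S - O1"] by (cases "2 * card O1 \<le> card S") auto
      have k2: "2 * k \<le> card S" using n by simp
      note J' = invariant_subset_small[OF U S J(1,3,4) k2 index]
      have "0 < card J" using J S finite_subset card_gt_0_iff by metis
      have cSJ: "card (S - J) = card S - card J" using J S by (simp add: card_Diff_subset finite_subset)
      have "\<exists>Z\<subseteq>S - J. card (S - J) \<le> card Z + (k - card J) \<and>
          contains_alt (U \<inter> {g. g permutes (S - J)}) Z"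
      proof (rule less.hyps)
        show "card (S - J) < card S" using cSJ \<open>0 < card J\<close> J(3) by simp
        show "finite (S - J)" using S by simp
        show "perm_group (S - J) (U \<inter> {g. g permutes (S - J)})" by (rule perm_group_Int_Sym[OF U])
        show "4 * (k - card J) + 2 \<le> card (S - J)" using n J'(1) cSJ by simp
        \<comment> \<open>Removing j \<ge> 1 points leaves slack: n - j \<ge> 4 (k - j) + 2 + 3j, so
          n - j = 6 and k - j = 1 cannot occur together.\<close>
        show "\<not> (card (S - J) = 6 \<and> k - card J = 1)" using n J'(1) cSJ \<open>0 < card J\<close> by simp
        show "fact (card (S - J))
            \<le> (card (S - J) choose (k - card J)) * card (U \<inter> {g. g permutes (S - J)})"
          unfolding cSJ by (rule J'(2))
      qed
      then obtain Z where Z: "Z \<subseteq> S - J" "card (S - J) \<le> card Z + (k - card J)"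
        "contains_alt (U \<inter> {g. g permutes (S - J)}) Z" by blast
      have "card S \<le> card Z + k" using Z(2) cSJ J'(1) J(3) by simp
      moreover have "contains_alt U Z" using Z(3) by (rule contains_alt_mono) auto
      ultimately show ?thesis using Z(1) by blast
    qed
  qed
qed

section \<open>Sums over perfect matchings\<close>

definition perfect_matchings :: "'a set \<Rightarrow> 'a set set set" where
  "perfect_matchings X = {M. (\<forall>e\<in>M. card e = 2) \<and> disjoint M \<and> \<Union>M = X}"

lemma finite_perfect_matchings: "finite X \<Longrightarrow> finite (perfect_matchings X)"
  by (rule finite_subset[of _ "Pow (Pow X)"]) (auto simp: perfect_matchings_def)

lemma perfect_matchings_finite: "finite X \<Longrightarrow> M \<in> perfect_matchings X \<Longrightarrow> finite M"
  by (auto simp: perfect_matchings_def intro: finite_UnionD)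

lemma perfect_matchings_empty: "perfect_matchings {} = {{}}"
  by (auto simp: perfect_matchings_def) (metis card.empty zero_neq_numeral)

lemma perfect_matchings_Un:
  assumes "R \<in> perfect_matchings Y" "M \<in> perfect_matchings X" "Y \<inter> X = {}"
  shows "R \<union> M \<in> perfect_matchings (Y \<union> X)"
proof -
  have "disjoint (R \<union> M)" using assms by (intro disjoint_union) (auto simp: perfect_matchings_def)
  then show ?thesis using assms by (auto simp: perfect_matchings_def)
qed

lemma perfect_matchings_edge: "a \<noteq> b \<Longrightarrow> {{a, b}} \<in> perfect_matchings {a, b}"
  by (auto simp: perfect_matchings_def)

lemma perfect_matchings_insert:
  assumes "M \<in> perfect_matchings (X - {w, z})" "w \<in> X" "z \<in> X" "w \<noteq> z"
  shows "insert {w, z} M \<in> perfect_matchings X" "{w, z} \<notin> M"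
proof -
  have "{w, z} \<union> (X - {w, z}) = X" using assms by auto
  then show "insert {w, z} M \<in> perfect_matchings X"
    using perfect_matchings_Un[OF perfect_matchings_edge[OF assms(4)] assms(1)] by (metis Diff_disjoint insert_is_Un)
  show "{w, z} \<notin> M" using assms(1) by (auto simp: perfect_matchings_def)
qed

lemma perfect_matchings_remove:
  assumes "M \<in> perfect_matchings X" "e \<in> M"
  shows "M - {e} \<in> perfect_matchings (X - e)"
  using assms unfolding perfect_matchings_def disjoint_def by auto

lemma perfect_matchings_partner:
  assumes "M \<in> perfect_matchings X" "w \<in> X"
  obtains z where "z \<in> X - {w}" "{w, z} \<in> M"
proof -
  obtain e where e: "e \<in> M" "w \<in> e" using assms by (auto simp: perfect_matchings_def)
  then have "card e = 2" using assms by (auto simp: perfect_matchings_def)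
  then obtain z where "e = {w, z}" "z \<noteq> w" using e(2) by (auto simp: card_2_iff)
  then show ?thesis using that[of z] e assms by (auto simp: perfect_matchings_def)
qed

text \<open>Perfect matchings are classified by the partner \<open>z\<close> of the fixed node
  \<open>w\<close>; deleting the edge {w, z} is inverse to inserting it.\<close>

lemma sum_perfect_matchings:
  assumes X: "finite X" and w: "w \<in> X"
  shows "(\<Sum>M\<in>perfect_matchings X. g M)
    = (\<Sum>z\<in>X - {w}. \<Sum>M\<in>perfect_matchings (X - {w, z}). g (insert {w, z} M))"
proof -
  let ?D = "SIGMA z:X - {w}. perfect_matchings (X - {w, z})" and ?f = "\<lambda>(z, M). insert {w, z} M"
  have "inj_on ?f ?D"
  proof (rule inj_onI)
    fix p p' assume p: "p \<in> ?D" "p' \<in> ?D" and f: "?f p = ?f p'"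
    obtain z M z' M' where p_def: "p = (z, M)" "p' = (z', M')" by (metis surj_pair)
    then have M: "M \<in> perfect_matchings (X - {w, z})" "M' \<in> perfect_matchings (X - {w, z'})"
      and z: "z \<in> X" "z' \<in> X" "z \<noteq> w" "z' \<noteq> w" and e: "insert {w, z} M = insert {w, z'} M'"
      using p f by auto
    have "{w, z} \<notin> M'" using M by (auto simp: perfect_matchings_def)
    then have "{w, z} = {w, z'}" using e by blast
    then have zz: "z = z'" by (auto simp: doubleton_eq_iff)
    have "{w, z} \<notin> M" "{w, z} \<notin> M'"
      using perfect_matchings_insert(2) M w z zz by metis+
    then have "M = M'" using e zz insert_ident by metis
    then show "p = p'" using zz p_def by simp
  qed
  moreover have "?f ` ?D = perfect_matchings X"
  proof
    show "?f ` ?D \<subseteq> perfect_matchings X" using w perfect_matchings_insert(1) by fastforce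
    show "perfect_matchings X \<subseteq> ?f ` ?D"
    proof
      fix M assume M: "M \<in> perfect_matchings X"
      obtain z where z: "z \<in> X - {w}" "{w, z} \<in> M" using perfect_matchings_partner[OF M w] .
      then have "(z, M - {{w, z}}) \<in> ?D" using perfect_matchings_remove[OF M] by auto
      moreover have "M = ?f (z, M - {{w, z}})" using z by auto
      ultimately show "M \<in> ?f ` ?D" by blast
    qed
  qed
  ultimately have "(\<Sum>M\<in>perfect_matchings X. g M) = (\<Sum>x\<in>?D. g (?f x))"
    by (metis (no_types, lifting) sum.reindex_cong)
  also have "\<dots> = (\<Sum>(z, M)\<in>?D. g (insert {w, z} M))" by (rule sum.cong) auto
  also have "\<dots> = (\<Sum>z\<in>X - {w}. \<Sum>M\<in>perfect_matchings (X - {w, z}). g (insert {w, z} M))"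
    using X by (intro sum.Sigma[symmetric]) (auto simp: finite_perfect_matchings)
  finally show ?thesis .
qed

section \<open>Sums over matchings with a given number of crossing edges\<close>

definition crossings :: "'a set \<Rightarrow> 'a set set \<Rightarrow> nat" where
  "crossings A M = card {e \<in> M. \<not> e \<subseteq> A \<and> \<not> e \<subseteq> - A}"

lemma crossings_Compl: "crossings (- A) M = crossings A M"
  unfolding crossings_def by (rule arg_cong[of _ _ card]) auto

lemma crossings_insert:
  assumes "finite M" "{w, z} \<notin> M"
  shows "crossings A (insert {w, z} M) = crossings A M + (if w \<in> A \<longleftrightarrow> z \<in> A then 0 else 1)"
proof -
  have "{e \<in> insert {w, z} M. \<not> e \<subseteq> A \<and> \<not> e \<subseteq> - A} =
    (if w \<in> A \<longleftrightarrow> z \<in> A then {} else {{w, z}}) \<union> {e \<in> M. \<not> e \<subseteq> A \<and> \<not> e \<subseteq> - A}"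
    by auto
  then show ?thesis using assms by (auto simp: crossings_def)
qed

definition matching_sum :: "'a set \<Rightarrow> 'a set \<Rightarrow> nat \<Rightarrow> ('a set set \<Rightarrow> real) \<Rightarrow> real" where
  "matching_sum A X i \<psi> = (\<Sum>M\<in>perfect_matchings X. if crossings A M = i then \<psi> M else 0)"

text \<open>This lets the inductions assume that the chosen node lies in \<open>A\<close>.\<close>

lemma matching_sum_Compl: "matching_sum (- A) X i \<psi> = matching_sum A X i \<psi>"
  by (simp add: matching_sum_def crossings_Compl)

text \<open>The edge at \<open>w\<close> uses up one crossing exactly if the partner lies on the
  other side. The guard \<open>i = 0\<close> is there because \<open>i - 1\<close> is
  truncated.\<close>

lemma matching_sum_rec:
  assumes X: "finite X" and w: "w \<in> X"
  shows "matching_sum A X i \<psi> = (\<Sum>z\<in>X - {w}.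
    if w \<in> A \<longleftrightarrow> z \<in> A then matching_sum A (X - {w, z}) i (\<lambda>M. \<psi> (insert {w, z} M))
    else if i = 0 then 0 else matching_sum A (X - {w, z}) (i - 1) (\<lambda>M. \<psi> (insert {w, z} M)))"
  unfolding matching_sum_def sum_perfect_matchings[OF X w]
proof (rule sum.cong[OF refl])
  fix z assume z: "z \<in> X - {w}"
  have "crossings A (insert {w, z} M) = crossings A M + (if w \<in> A \<longleftrightarrow> z \<in> A then 0 else 1)"
    if "M \<in> perfect_matchings (X - {w, z})" for M
    using z w that X perfect_matchings_insert(2)[OF that]
    by (intro crossings_insert perfect_matchings_finite[OF _ that]) auto
  then show "(\<Sum>M\<in>perfect_matchings (X - {w, z}).
        if crossings A (insert {w, z} M) = i then \<psi> (insert {w, z} M) else 0) =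
    (if w \<in> A \<longleftrightarrow> z \<in> A then \<Sum>M\<in>perfect_matchings (X - {w, z}).
          if crossings A M = i then \<psi> (insert {w, z} M) else 0
     else if i = 0 then 0 else \<Sum>M\<in>perfect_matchings (X - {w, z}).
          if crossings A M = i - 1 then \<psi> (insert {w, z} M) else 0)"
    by (cases i) (auto intro!: sum.cong sum.neutral)
qed

text \<open>
  The numbers of perfect matchings of \<open>m\<close> points (for even \<open>m\<close>), and of those perfect matchings of
  \<open>a + b\<close> points that have exactly \<open>i\<close> edges between the two parts.
\<close>

definition num_pairings :: "nat \<Rightarrow> real" where
  "num_pairings m = 2 ^ (m div 2) * fact (m div 2)"

definition num_matchings :: "nat \<Rightarrow> nat \<Rightarrow> nat \<Rightarrow> real" where
  "num_matchings a b i = (if i \<le> a \<and> i \<le> b \<and> even (a - i) \<and> even (b - i)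
    then fact a * fact b / (fact i * num_pairings (a - i) * num_pairings (b - i)) else 0)"

lemma num_pairings_pos: "0 < num_pairings m"
  by (simp add: num_pairings_def)

text \<open>For even m, \<open>num_pairings m\<close> is the double factorial 2 4 ... m, the number
  of ways to list one perfect matching as a sequence of ordered pairs. Thus m! divided by it counts
  the perfect matchings of m points, which explains the denominators in
  \<open>num_matchings\<close>.\<close>

lemma num_pairings_Suc_Suc: "even m \<Longrightarrow> num_pairings (Suc (Suc m)) = real (m + 2) * num_pairings m"
  by (auto simp: num_pairings_def elim!: evenE)

lemma num_matchings_commute: "num_matchings a b i = num_matchings b a i"
  by (auto simp: num_matchings_def mult_ac)

text \<open>The factor is the share of matchings that contain a given crossing edge: i + 1 of the (a
  + 1)(b + 1) possible crossing edges are used.\<close>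

lemma num_matchings_Suc_Suc_Suc:
  "num_matchings a b i
    = num_matchings (Suc a) (Suc b) (Suc i) * (real (Suc i) / (real (Suc a) * real (Suc b)))"
  using num_pairings_pos[of "a - i"] num_pairings_pos[of "b - i"]
  by (auto simp: num_matchings_def divide_simps simp del: of_nat_Suc)

text \<open>Here the factor is the share that contain a given edge inside the first part: (a + 2 -
  i) / 2 of its (a + 2)(a + 1) / 2 edges are used. For i = a + 1 parity makes both sides 0, and for
  i = a + 2 the factor vanishes.\<close>

lemma num_matchings_Suc_Suc:
  "num_matchings a b i
    = num_matchings (Suc (Suc a)) b i * ((real a + 2 - real i) / (real (a + 2) * real (a + 1)))"
proof -
  consider "i \<le> a" | "i = Suc a" | "i = Suc (Suc a)" | "i > Suc (Suc a)" by linarith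
  then show ?thesis
  proof cases
    case 1
    then have e: "Suc (Suc a) - i = Suc (Suc (a - i))" by simp
    have r: "real (a - i + 2) = real a + 2 - real i" using 1 by simp
    show ?thesis
    proof (cases "i \<le> b \<and> even (a - i) \<and> even (b - i)")
      case True
      define r where "r = real a + 2 - real i"
      have "num_pairings (Suc (Suc (a - i))) = r * num_pairings (a - i)"
        using num_pairings_Suc_Suc[of "a - i"] True 1 by (simp add: r_def)
      moreover have "0 < r" using 1 by (simp add: r_def)
      ultimately show ?thesis
        using True 1 num_pairings_pos[of "a - i"] num_pairings_pos[of "b - i"]
        unfolding r_def[symmetric] num_matchings_def e by (simp add: divide_simps)
    next
      case False
      then show ?thesis using 1 e by (auto simp: num_matchings_def)
    qed
  qed (auto simp: num_matchings_def)
qed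

lemma num_matchings_pos:
  "i \<le> a \<Longrightarrow> i \<le> b \<Longrightarrow> even (a - i) \<Longrightarrow> even (b - i) \<Longrightarrow> 0 < num_matchings a b i"
  by (simp add: num_matchings_def num_pairings_pos)

text \<open>The recursion is normalized by the number of matchings, so that only the two shares
  remain as weights. Both the count itself and the polynomial form of averages are obtained from
  this one step.\<close>

lemma matching_sum_step:
  assumes X: "finite X" and w: "w \<in> X" "w \<in> A"
    and q: "\<And>z j. z \<in> X - {w} \<Longrightarrow> matching_sum A (X - {w, z}) j (\<lambda>M. \<psi> (insert {w, z} M))
      = num_matchings (card ((X - {w, z}) \<inter> A)) (card (X - {w, z} - A)) j * q z (real j)"
  defines "a \<equiv> card (X \<inter> A)" and "b \<equiv> card (X - A)"
  shows "matching_sum A X i \<psi> = num_matchings a b i *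
    ((\<Sum>z\<in>X \<inter> A - {w}. (real a - real i) / (real a * (real a - 1)) * q z (real i)) +
     (\<Sum>z\<in>X - A. real i / (real a * real b) * q z (real i - 1)))"
proof -
  let ?f = "\<lambda>z. if w \<in> A \<longleftrightarrow> z \<in> A then matching_sum A (X - {w, z}) i (\<lambda>M. \<psi> (insert {w, z} M))
    else if i = 0 then 0 else matching_sum A (X - {w, z}) (i - 1) (\<lambda>M. \<psi> (insert {w, z} M))"
  have fin: "finite (X \<inter> A)" "finite (X - A)" using X by auto
  have a1: "card (X \<inter> A - {w}) = a - 1" using w fin by (simp add: a_def)
  have "X - {w} = (X \<inter> A - {w}) \<union> (X - A)" using w by auto
  then have "matching_sum A X i \<psi> = sum ?f ((X \<inter> A - {w}) \<union> (X - A))"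
    using matching_sum_rec[OF X w(1)] by metis
  also have "\<dots> = sum ?f (X \<inter> A - {w}) + sum ?f (X - A)"
    using X by (intro sum.union_disjoint) auto
  also have "sum ?f (X \<inter> A - {w}) = (\<Sum>z\<in>X \<inter> A - {w}.
      num_matchings a b i * ((real a - real i) / (real a * (real a - 1)) * q z (real i)))"
  proof (rule sum.cong[OF refl])
    fix z assume z: "z \<in> X \<inter> A - {w}"
    have "(X - {w, z}) \<inter> A = X \<inter> A - {w} - {z}" "X - {w, z} - A = X - A" using w z by auto
    then have c: "card ((X - {w, z}) \<inter> A) = a - 2" "card (X - {w, z} - A) = b"
      using a1 z fin by (simp_all add: b_def)
    \<comment> \<open>The existence of \<open>z\<close> gives a \<ge> 2, so \<open>a - 2\<close> is
      not truncated and the denominator is nonzero.\<close>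
    have "0 < card (X \<inter> A - {w})" using z fin by (metis card_gt_0_iff empty_iff finite_Diff)
    then obtain a' where a': "a = Suc (Suc a')" using a1 by (metis Suc_pred not0_implies_Suc zero_less_diff neq0_conv zero_diff One_nat_def diff_Suc_1)
    have "?f z = num_matchings (a - 2) b i * q z (real i)" using z w q[of z i] c by simp
    also have "num_matchings (a - 2) b i
        = num_matchings a b i * ((real a - real i) / (real a * (real a - 1)))"
      using num_matchings_Suc_Suc[of a' b i] by (simp add: a' algebra_simps)
    finally show "?f z = num_matchings a b i * ((real a - real i) / (real a * (real a - 1)) * q z (real i))"
      by simp
  qed
  also have "sum ?f (X - A) = (\<Sum>z\<in>X - A.
      num_matchings a b i * (real i / (real a * real b) * q z (real i - 1)))"
  proof (rule sum.cong[OF refl])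
    fix z assume z: "z \<in> X - A"
    show "?f z = num_matchings a b i * (real i / (real a * real b) * q z (real i - 1))"
    proof (cases i)
      case 0
      then show ?thesis using z w by simp
    next
      case (Suc j)
      have "(X - {w, z}) \<inter> A = X \<inter> A - {w}" "X - {w, z} - A = X - A - {z}" using w z by auto
      then have c: "card ((X - {w, z}) \<inter> A) = a - 1" "card (X - {w, z} - A) = b - 1"
        using a1 z fin by (simp_all add: b_def)
      have "0 < a" "0 < b" using z w fin by (auto simp: a_def b_def card_gt_0_iff)
      then obtain a' b' where ab: "a = Suc a'" "b = Suc b'" by (metis gr0_implies_Suc)
      have "?f z = num_matchings (a - 1) (b - 1) j * q z (real j)" using z w q[of z j] c Suc by auto
      also have "num_matchings (a - 1) (b - 1) j = num_matchings a b i * (real i / (real a * real b))"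
        using num_matchings_Suc_Suc_Suc[of a' b' j] by (simp add: ab Suc)
      finally show ?thesis by (simp add: Suc)
    qed
  qed
  finally show ?thesis by (simp add: sum_distrib_left distrib_left)
qed

lemma matching_sum_one:
  assumes "finite X"
  shows "matching_sum A X i (\<lambda>_. 1) = num_matchings (card (X \<inter> A)) (card (X - A)) i"
  using assms
proof (induction "card X" arbitrary: X A i rule: less_induct)
  case less
  have main: "matching_sum A X i (\<lambda>_. 1) = num_matchings (card (X \<inter> A)) (card (X - A)) i"
    if w: "w \<in> X" "w \<in> A" for A :: "'a set" and w i
  proof -
    let ?a = "card (X \<inter> A)" and ?b = "card (X - A)"
    have IH: "matching_sum A (X - {w, z}) j (\<lambda>_. 1)
        = num_matchings (card ((X - {w, z}) \<inter> A)) (card (X - {w, z} - A)) j * 1" for z j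
    proof -
      have "card (X - {w, z}) < card X" using w less.prems by (intro psubset_card_mono) auto
      then show ?thesis using less by simp
    qed
    have a: "card (X \<inter> A - {w}) = ?a - 1" "0 < ?a"
      using w less.prems by (auto simp: card_gt_0_iff)
    have "matching_sum A X i (\<lambda>_. 1) = num_matchings ?a ?b i *
      (real (?a - 1) * ((real ?a - real i) / (real ?a * (real ?a - 1)))
        + real ?b * (real i / (real ?a * real ?b)))"
      using matching_sum_step[OF less.prems w, of "\<lambda>_. 1" "\<lambda>_ _. 1" i] IH a by simp
    \<comment> \<open>The weights add up to (a - i) / a + i / a = 1. Cancelling a - 1 fails for a =
      1, but then i = 1 by parity; cancelling b fails for b = 0, but then i = 0.\<close>
    also have "\<dots> = num_matchings ?a ?b i"
    proof (cases "num_matchings ?a ?b i = 0")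
      case False
      then have i: "i \<le> ?a" "i \<le> ?b" "even (?a - i)" by (auto simp: num_matchings_def split: if_splits)
      have "real (?a - 1) * ((real ?a - real i) / (real ?a * (real ?a - 1))) = (real ?a - real i) / real ?a"
      proof (cases "?a = 1")
        case True
        then have "i = 1" using i by (cases i) auto
        then show ?thesis using True by simp
      next
        case False
        then have "real (?a - 1) = real ?a - 1" "real ?a - 1 \<noteq> 0" using a(2) by auto
        then show ?thesis by simp
      qed
      moreover have "real ?b * (real i / (real ?a * real ?b)) = real i / real ?a"
        using i by (cases "?b = 0") auto
      ultimately show ?thesis using a(2) by (simp add: diff_divide_distrib)
    qed simp
    finally show ?thesis .
  qed
  show ?case
  proof (cases "X = {}")
    case True
    then show ?thesis
      by (auto simp: matching_sum_def perfect_matchings_empty num_matchings_def crossings_def num_pairings_def)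
  next
    case False
    then obtain w where w: "w \<in> X" by blast
    show ?thesis
    proof (cases "w \<in> A")
      case True
      then show ?thesis using main w by blast
    next
      case False
      then have "matching_sum (- A) X i (\<lambda>_. 1) = num_matchings (card (X \<inter> - A)) (card (X - - A)) i"
        using main[of w "- A"] w by simp
      moreover have "X \<inter> - A = X - A" "X - - A = X \<inter> A" by auto
      ultimately show ?thesis by (simp add: matching_sum_Compl num_matchings_commute)
    qed
  qed
qed

section \<open>Functions of a perfect matching that depend on few nodes\<close>

lemma perfect_matchings_image:
  assumes g: "g permutes X" and M: "M \<in> perfect_matchings X"
  shows "(`) g ` M \<in> perfect_matchings X"
proof -
  have i: "inj g" using g by (rule permutes_inj)
  have "disjoint ((`) g ` M)"
  proof (rule disjointI)
    fix a b assume "a \<in> (`) g ` M" "b \<in> (`) g ` M" "a \<noteq> b"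
    then obtain e f where ef: "e \<in> M" "f \<in> M" "e \<noteq> f" "a = g ` e" "b = g ` f" by blast
    then have "e \<inter> f = {}" using M by (auto simp: perfect_matchings_def disjoint_def)
    then show "a \<inter> b = {}" using ef i by (simp add: image_Int[symmetric])
  qed
  moreover have "\<Union> ((`) g ` M) = X"
    using M permutes_image[OF g] by (simp add: perfect_matchings_def image_Union[symmetric])
  moreover have "card (g ` e) = card e" for e using i by (meson card_image inj_on_subset subset_UNIV)
  ultimately show ?thesis using M by (auto simp: perfect_matchings_def)
qed

text \<open>The 3-cycles on \<open>X\<close> already connect any two perfect matchings of
  \<open>X\<close>. If a node has the same partner in both, that edge moves to \<open>R\<close> and
  induction applies; otherwise a 3-cycle first makes the partners agree.\<close>

lemma cyc3_invariant_on_perfect_matchings: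
  fixes \<phi> :: "'a set set \<Rightarrow> 'b"
  assumes inv: "\<And>a b c N. distinct [a, b, c] \<Longrightarrow> {a, b, c} \<subseteq> Z \<Longrightarrow> N \<in> perfect_matchings V
      \<Longrightarrow> \<phi> ((`) (cyc3 a b c) ` N) = \<phi> N"
  assumes "finite X" "X \<subseteq> Z" "Y \<union> X = V" "Y \<inter> X = {}"
    and "R \<in> perfect_matchings Y" "M \<in> perfect_matchings X" "M' \<in> perfect_matchings X"
  shows "\<phi> (R \<union> M) = \<phi> (R \<union> M')"
  using assms(2-)
proof (induction "card X" arbitrary: X Y R M M' rule: less_induct)
  case less
  note X = less.prems(1-4) and R = less.prems(5) and M = less.prems(6) and M' = less.prems(7)
  show ?case
  proof (cases "X = {}")
    case True
    then show ?thesis using M M' by (simp add: perfect_matchings_empty)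
  next
    case False
    then obtain x where x: "x \<in> X" by blast
    obtain y where y: "y \<in> X - {x}" "{x, y} \<in> M" using perfect_matchings_partner[OF M x] .
    obtain y' where y': "y' \<in> X - {x}" "{x, y'} \<in> M'" using perfect_matchings_partner[OF M' x] .
    have same: "\<phi> (R \<union> M) = \<phi> (R \<union> N)" if N: "N \<in> perfect_matchings X" "{x, y} \<in> N" for N
    proof -
      have "card (X - {x, y}) < card X" using x X(1) by (intro psubset_card_mono) auto
      moreover have "finite (X - {x, y})" "X - {x, y} \<subseteq> Z" using X by auto
      moreover have "(Y \<union> {x, y}) \<union> (X - {x, y}) = V" "(Y \<union> {x, y}) \<inter> (X - {x, y}) = {}"
        using X x y by auto
      moreover have "R \<union> {{x, y}} \<in> perfect_matchings (Y \<union> {x, y})"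
        using x y X by (intro perfect_matchings_Un[OF R perfect_matchings_edge]) auto
      ultimately have "\<phi> (R \<union> {{x, y}} \<union> (M - {{x, y}})) = \<phi> (R \<union> {{x, y}} \<union> (N - {{x, y}}))"
        using perfect_matchings_remove[OF M y(2)] perfect_matchings_remove[OF N] by (rule less.hyps)
      moreover have "R \<union> {{x, y}} \<union> (M - {{x, y}}) = R \<union> M" "R \<union> {{x, y}} \<union> (N - {{x, y}}) = R \<union> N"
        using y N by auto
      ultimately show ?thesis by simp
    qed
    show ?thesis
    proof (cases "y = y'")
      case True
      then show ?thesis using same M' y' by simp
    next
      case False
      obtain z where z: "z \<in> X - {y}" "{y, z} \<in> M'"
        using perfect_matchings_partner[OF M', of y] y by auto
      have dis: "e = f" if "e \<in> M'" "f \<in> M'" "e \<inter> f \<noteq> {}" for e f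
        using M' that by (auto simp: perfect_matchings_def disjoint_def)
      have "z \<noteq> x" using dis[OF y'(2) z(2)] False y by (auto simp: doubleton_eq_iff)
      moreover have "z \<noteq> y'" using dis[OF y'(2) z(2)] False y y' by (auto simp: doubleton_eq_iff)
      ultimately have d: "distinct [y', y, z]" "x \<notin> {y', y, z}" using False y y' z by auto
      \<comment> \<open>The partner \<open>z\<close> of \<open>y\<close> in \<open>M'\<close> is the
        third point needed: the cycle sends y' to y and fixes \<open>x\<close>, so the image of
        \<open>M'\<close> contains {x, y}.\<close>
      let ?c = "cyc3 y' y z"
      have sub: "{y', y, z} \<subseteq> X" using y y' z by auto
      have cX: "?c permutes X" using d(1) sub by (rule cyc3_permutes)
      have "?c ` {x, y'} = {x, y}" using d by (auto simp: cyc3_def)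
      then have "{x, y} \<in> (`) ?c ` M'" using y'(2) by (metis imageI)
      then have "\<phi> (R \<union> M) = \<phi> (R \<union> (`) ?c ` M')"
        using same perfect_matchings_image[OF cX M'] by blast
      also have "R \<union> (`) ?c ` M' = (`) ?c ` (R \<union> M')"
      proof -
        have "?c ` e = e" if "e \<in> R" for e
        proof -
          have "e \<inter> {y', y, z} = {}" using that R X(4) sub by (auto simp: perfect_matchings_def)
          then show ?thesis by (auto simp: cyc3_def image_def)
        qed
        then have "(`) ?c ` R = R" by (simp cong: image_cong)
        then show ?thesis by (simp add: image_Un)
      qed
      also have "\<phi> \<dots> = \<phi> (R \<union> M')"
        using sub X perfect_matchings_Un[OF R M' X(4)] by (intro inv d(1)) auto
      finally show ?thesis .
    qed
  qed
qed

text \<open>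
  The hypothesis on \<open>\<psi>\<close> says that it only depends on the edges that meet \<open>W\<close>. The proof matches the
  nodes of \<open>W\<close> one by one. A crossing edge contributes a factor \<open>i\<close>, so only edges inside a part
  contribute to the value at 0.
\<close>

lemma matching_sum_polynomial:
  assumes "finite W" "finite X"
    and "\<And>M. M \<in> perfect_matchings X \<Longrightarrow> 0 \<le> \<psi> M"
    and "\<And>Y Z R M M'. Y \<union> Z = X \<Longrightarrow> Y \<inter> Z = {} \<Longrightarrow> Z \<inter> W = {} \<Longrightarrow> R \<in> perfect_matchings Y \<Longrightarrow>
      M \<in> perfect_matchings Z \<Longrightarrow> M' \<in> perfect_matchings Z \<Longrightarrow> \<psi> (R \<union> M) = \<psi> (R \<union> M')"
  shows "\<exists>q. degree q \<le> card W \<and>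
    (\<forall>i. matching_sum A X i \<psi> = num_matchings (card (X \<inter> A)) (card (X - A)) i * poly q (real i)) \<and>
    (2 * card W \<le> card (X \<inter> A) \<and> 2 * card W \<le> card (X - A) \<longrightarrow> 0 \<le> poly q 0)"
  using assms
proof (induction W arbitrary: X \<psi> A rule: finite_induct)
  case empty
  \<comment> \<open>With no special nodes, locality for Y = {} and R = {} makes
    \<open>\<psi>\<close> constant. If \<open>X\<close> has no perfect matching, 0 serves.\<close>
  have "\<exists>c\<ge>0. \<forall>M\<in>perfect_matchings X. \<psi> M = c"
  proof (cases "perfect_matchings X = {}")
    case False
    then obtain M where M: "M \<in> perfect_matchings X" by blast
    have "\<psi> N = \<psi> M" if "N \<in> perfect_matchings X" for N
      using empty.prems(3)[of "{}" X "{}" N M] M that by (simp add: perfect_matchings_empty)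
    then show ?thesis using empty.prems(2)[OF M] by blast
  next
    case True
    then show ?thesis by (intro exI[of _ 0]) simp
  qed
  then obtain c where c: "0 \<le> c" "\<And>M. M \<in> perfect_matchings X \<Longrightarrow> \<psi> M = c" by blast
  have "matching_sum A X i \<psi> = matching_sum A X i (\<lambda>_. 1) * c" for i
    unfolding matching_sum_def sum_distrib_right by (rule sum.cong[OF refl]) (simp add: c(2))
  then show ?case
    using c(1) matching_sum_one[OF empty.prems(1)] by (intro exI[of _ "[:c:]"]) simp
next
  case (insert w W)
  note X = insert.prems(1) and pos = insert.prems(2) and const = insert.prems(3)
  have cW: "card (insert w W) = Suc (card W)" using insert.hyps by simp
  show ?case
  proof (cases "w \<in> X")
    case False
    have "\<exists>q. degree q \<le> card W \<and>
      (\<forall>i. matching_sum A X i \<psi> = num_matchings (card (X \<inter> A)) (card (X - A)) i * poly q (real i)) \<and>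
      (2 * card W \<le> card (X \<inter> A) \<and> 2 * card W \<le> card (X - A) \<longrightarrow> 0 \<le> poly q 0)"
    proof (rule insert.IH[OF X pos])
      fix Y Z R M M'
      assume "Y \<union> Z = X" "Y \<inter> Z = {}" "Z \<inter> W = {}" "R \<in> perfect_matchings Y"
        "M \<in> perfect_matchings Z" "M' \<in> perfect_matchings Z"
      then show "\<psi> (R \<union> M) = \<psi> (R \<union> M')" using False by (intro const[of Y Z]) auto
    qed
    then obtain q where q: "degree q \<le> card W"
      "\<forall>i. matching_sum A X i \<psi> = num_matchings (card (X \<inter> A)) (card (X - A)) i * poly q (real i)"
      "2 * card W \<le> card (X \<inter> A) \<and> 2 * card W \<le> card (X - A) \<longrightarrow> 0 \<le> poly q 0"
      by blast
    then show ?thesis unfolding cW by (intro exI[of _ q]) auto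
  next
    case w: True
    \<comment> \<open>The case of \<open>w\<close> outside \<open>A\<close> reduces to this one by
      exchanging \<open>A\<close> with its complement.\<close>
    have main: "\<exists>q. degree q \<le> Suc (card W) \<and>
      (\<forall>i. matching_sum A X i \<psi> = num_matchings (card (X \<inter> A)) (card (X - A)) i * poly q (real i)) \<and>
      (2 * Suc (card W) \<le> card (X \<inter> A) \<and> 2 * Suc (card W) \<le> card (X - A) \<longrightarrow> 0 \<le> poly q 0)"
      if wA: "w \<in> A" for A
    proof -
      let ?a = "card (X \<inter> A)" and ?b = "card (X - A)"
      have fin: "finite (X \<inter> A)" "finite (X - A)" using X by auto
      define P where "P z q \<longleftrightarrow> degree q \<le> card W \<and>
        (\<forall>i. matching_sum A (X - {w, z}) i (\<lambda>M. \<psi> (insert {w, z} M))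
          = num_matchings (card ((X - {w, z}) \<inter> A)) (card (X - {w, z} - A)) i * poly q (real i)) \<and>
        (2 * card W \<le> card ((X - {w, z}) \<inter> A) \<and> 2 * card W \<le> card (X - {w, z} - A) \<longrightarrow> 0 \<le> poly q 0)"
        for z q
      have "\<exists>q. P z q" if z: "z \<in> X - {w}" for z
        unfolding P_def
      proof (rule insert.IH)
        show "finite (X - {w, z})" using X by simp
        show "0 \<le> \<psi> (insert {w, z} M)" if "M \<in> perfect_matchings (X - {w, z})" for M
          using perfect_matchings_insert(1)[OF that] z w by (intro pos) auto
        fix Y Z R M M'
        assume YZ: "Y \<union> Z = X - {w, z}" "Y \<inter> Z = {}" "Z \<inter> W = {}" and R: "R \<in> perfect_matchings Y"
          and M: "M \<in> perfect_matchings Z" "M' \<in> perfect_matchings Z"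
        have "insert {w, z} R \<in> perfect_matchings (Y \<union> {w, z})"
          using perfect_matchings_Un[OF R perfect_matchings_edge[of w z]] YZ z by auto
        then have "\<psi> (insert {w, z} R \<union> M) = \<psi> (insert {w, z} R \<union> M')"
          using YZ z w by (intro const[of "Y \<union> {w, z}" Z] M) auto
        then show "\<psi> (insert {w, z} (R \<union> M)) = \<psi> (insert {w, z} (R \<union> M'))" by simp
      qed
      then obtain q where "\<And>z. z \<in> X - {w} \<Longrightarrow> P z (q z)" by metis
      then have deg: "\<And>z. z \<in> X - {w} \<Longrightarrow> degree (q z) \<le> card W"
        and q: "\<And>z i. z \<in> X - {w} \<Longrightarrow> matching_sum A (X - {w, z}) i (\<lambda>M. \<psi> (insert {w, z} M))
          = num_matchings (card ((X - {w, z}) \<inter> A)) (card (X - {w, z} - A)) i * poly (q z) (real i)"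
        and q0: "\<And>z. z \<in> X - {w} \<Longrightarrow> 2 * card W \<le> card ((X - {w, z}) \<inter> A) \<Longrightarrow>
          2 * card W \<le> card (X - {w, z} - A) \<Longrightarrow> 0 \<le> poly (q z) 0"
        by (auto simp: P_def)
      \<comment> \<open>The right side of \<open>matching_sum_step\<close> as a polynomial in i: the
        weights a - i and i raise the degree by one, and composition with [:-1, 1:] realizes the
        shift to i - 1.\<close>
      define Q where "Q =
        (\<Sum>z\<in>X \<inter> A - {w}. smult (1 / (real ?a * (real ?a - 1))) ([:real ?a, -1:] * q z)) +
        (\<Sum>z\<in>X - A. smult (1 / (real ?a * real ?b)) ([:0, 1:] * pcompose (q z) [:-1, 1:]))"
      have "degree Q \<le> Suc (card W)"
        unfolding Q_def
      proof (intro degree_add_le degree_sum_le fin finite_Diff)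
        fix z assume z: "z \<in> X \<inter> A - {w}"
        have "degree ([:real ?a, -1:] * q z) \<le> Suc (card W)"
          using deg[of z] z degree_mult_le[of "[:real ?a, -1:]" "q z"] by simp
        then show "degree (smult (1 / (real ?a * (real ?a - 1))) ([:real ?a, -1:] * q z)) \<le> Suc (card W)"
          by (rule order_trans[OF degree_smult_le])
      next
        fix z assume z: "z \<in> X - A"
        have "z \<in> X - {w}" using z wA by auto
        then have "degree (pcompose (q z) [:-1, 1:]) \<le> card W"
          using deg[of z] degree_pcompose_le[of "q z" "[:-1, 1:]"] by simp
        then have "degree ([:0, 1:] * pcompose (q z) [:-1, 1:]) \<le> Suc (card W)"
          using degree_mult_le[of "[:0, 1:]" "pcompose (q z) [:-1, 1:]"] by simp
        then show "degree (smult (1 / (real ?a * real ?b)) ([:0, 1:] * pcompose (q z) [:-1, 1:])) \<le> Suc (card W)"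
          by (rule order_trans[OF degree_smult_le])
      qed
      moreover have "matching_sum A X i \<psi> = num_matchings ?a ?b i * poly Q (real i)" for i
        using matching_sum_step[OF X w wA, of \<psi> "\<lambda>z. poly (q z)" i] q
        by (simp add: Q_def poly_sum poly_pcompose add.commute left_diff_distrib)
      \<comment> \<open>At 0 the crossing terms vanish. A partner inside \<open>A\<close> removes
        two nodes from \<open>A\<close> and none from the other side, so the size condition survives
        with one special node fewer.\<close>
      moreover have "0 \<le> poly Q 0" if big: "2 * Suc (card W) \<le> ?a" "2 * Suc (card W) \<le> ?b"
      proof -
        have "0 \<le> poly (q z) 0" if z: "z \<in> X \<inter> A - {w}" for z
        proof -
          have "(X - {w, z}) \<inter> A = X \<inter> A - {w} - {z}" "X - {w, z} - A = X - A"
            using z wA by blast+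
          then have "card ((X - {w, z}) \<inter> A) = ?a - 2" "card (X - {w, z} - A) = ?b"
            using z w wA fin by simp_all
          then show ?thesis using q0[of z] big z by simp
        qed
        then show ?thesis using big by (auto simp: Q_def poly_sum intro!: sum_nonneg divide_nonneg_nonneg)
      qed
      ultimately show ?thesis by (intro exI[of _ Q]) blast
    qed
    show ?thesis
    proof (cases "w \<in> A")
      case True
      then show ?thesis using main[OF True] unfolding cW by blast
    next
      case False
      have e: "X \<inter> - A = X - A" "X - - A = X \<inter> A" by auto
      have "w \<in> - A" using False by simp
      from main[OF this] obtain q where "degree q \<le> Suc (card W)"
        "\<And>i. matching_sum A X i \<psi> = num_matchings (card (X \<inter> A)) (card (X - A)) i * poly q (real i)"
        "2 * Suc (card W) \<le> card (X - A) \<and> 2 * Suc (card W) \<le> card (X \<inter> A) \<longrightarrow> 0 \<le> poly q 0"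
        unfolding matching_sum_Compl e num_matchings_commute[of "card (X - A)" "card (X \<inter> A)"]
        by blast
      then show ?thesis unfolding cW by (intro exI[of _ q]) simp
    qed
  qed
qed

text \<open>Lagrange interpolation: \<open>\<alpha> i\<close> is the value at \<open>x\<close> of
  the basis polynomial for the node i, hence independent of \<open>q\<close>.\<close>

lemma polynomial_extrapolation:
  fixes I :: "nat set" and x :: real
  assumes I: "finite I" "card I = Suc k"
  obtains \<alpha> where "\<And>q. degree q \<le> k \<Longrightarrow> (\<Sum>i\<in>I. \<alpha> i * poly q (real i)) = poly q x"
proof -
  define L where "L i = (\<Prod>j\<in>I - {i}. smult (1 / (real i - real j)) [:- real j, 1:])" for i
  have degL: "degree (L i) \<le> k" if "i \<in> I" for i
  proof -
    have "degree (L i) \<le> (\<Sum>j\<in>I - {i}. degree (smult (1 / (real i - real j)) [:- real j, 1:]))"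
      using degree_prod_sum_le[OF finite_Diff[OF I(1)], of "\<lambda>j. smult (1 / (real i - real j)) [:- real j, 1:]"]
      by (simp only: L_def comp_def)
    also have "\<dots> \<le> (\<Sum>j\<in>I - {i}. 1)" by (intro sum_mono) simp
    also have "\<dots> = k" using I that by simp
    finally show ?thesis .
  qed
  have polyL: "poly (L i) (real j) = (if i = j then 1 else 0)" if "i \<in> I" "j \<in> I" for i j
  proof (cases "i = j")
    case True
    then show ?thesis by (auto simp: L_def poly_prod divide_simps intro!: prod.neutral)
  next
    case False
    then show ?thesis using I that by (auto simp: L_def poly_prod prod_zero_iff)
  qed
  have "(\<Sum>i\<in>I. poly (L i) x * poly q (real i)) = poly q x" if q: "degree q \<le> k" for q
  proof -
    let ?r = "\<Sum>i\<in>I. smult (poly q (real i)) (L i)"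
    have "?r = q"
    proof (rule poly_eqI_degree)
      fix y assume "y \<in> real ` I"
      then obtain j where j: "j \<in> I" "y = real j" by blast
      have "poly ?r y = (\<Sum>i\<in>I. if i = j then poly q (real i) else 0)"
        unfolding poly_sum j(2) using polyL j(1) by (intro sum.cong) auto
      then show "poly ?r y = poly q y" using j I by simp
    next
      have c: "card (real ` I) = Suc k" using I by (simp add: card_image)
      have "degree ?r \<le> k"
        using I degL by (intro degree_sum_le order_trans[OF degree_smult_le]) auto
      then show "degree ?r < card (real ` I)" using c by simp
      show "degree q < card (real ` I)" using c q by simp
    qed
    then have "poly q x = poly ?r x" by simp
    then show ?thesis by (simp add: poly_sum mult.commute)
  qed
  then show ?thesis by (rule that[of "\<lambda>i. poly (L i) x"])
qed

section \<open>Symmetric subspace extensions\<close>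

lemma sum_fun_apply: "(\<Sum>i\<in>I. f i) x = (\<Sum>i\<in>I. f i x :: real)"
  by (induction I rule: infinite_finite_induct) auto

text \<open>Translation by one of the points turns \<open>A\<close> into a subspace, so coefficients
  of either sign are allowed.\<close>

lemma affine_combination_in:
  fixes y :: "'i \<Rightarrow> 'v::real_vector"
  assumes A: "affine A" and y: "\<And>i. i \<in> I \<Longrightarrow> y i \<in> A" and c: "sum c I = (1::real)"
  shows "(\<Sum>i\<in>I. c i *\<^sub>R y i) \<in> A"
proof -
  have "I \<noteq> {}" using c by auto
  then obtain i0 where i0: "i0 \<in> I" by blast
  let ?a = "y i0" and ?V = "(\<lambda>x. x - y i0) ` A"
  have V: "subspace ?V" using affine_diffs_subspace_subtract[OF A y[OF i0]] .
  have "(\<Sum>i\<in>I. c i *\<^sub>R (y i - ?a)) \<in> ?V"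
    using y by (intro subspace_sum[OF V] subspace_scale[OF V]) auto
  moreover have "(\<Sum>i\<in>I. c i *\<^sub>R (y i - ?a)) = (\<Sum>i\<in>I. c i *\<^sub>R y i) - ?a"
    using c by (simp add: scaleR_diff_right sum_subtractf flip: scaleR_sum_left)
  ultimately show ?thesis by auto
qed

lemma permute_coords_sum:
  "permute_coords \<kappa> (\<Sum>i\<in>I. c i *\<^sub>R y i) = (\<Sum>i\<in>I. c i *\<^sub>R permute_coords \<kappa> (y i))"
  by (simp add: permute_coords_def fun_eq_iff sum_fun_apply)

lemma permute_coords_comp:
  assumes "\<kappa> permutes S" "\<kappa>' permutes S"
  shows "permute_coords \<kappa> (permute_coords \<kappa>' y) = permute_coords (\<kappa> \<circ> \<kappa>') y"
  using assms by (simp add: permute_coords_def fun_eq_iff o_inv_distrib permutes_bij)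

lemma inj_permute_coords:
  assumes "\<kappa> permutes S"
  shows "inj (permute_coords \<kappa>)"
proof (rule injI)
  fix x y :: "'a \<Rightarrow> real" assume e: "permute_coords \<kappa> x = permute_coords \<kappa> y"
  show "x = y"
  proof
    fix i show "x i = y i"
      using fun_cong[OF e, of "\<kappa> i"] permutes_inverses(2)[OF assms] by (simp add: permute_coords_def)
  qed
qed

lemma inj_node_action:
  assumes "\<pi> permutes S"
  shows "inj (node_action \<pi>)"
proof (rule injI)
  fix x y :: "nat set \<Rightarrow> real" assume e: "node_action \<pi> x = node_action \<pi> y"
  show "x = y"
  proof
    fix f
    have "inv \<pi> ` \<pi> ` f = f" using permutes_inj[OF assms] by (rule image_inv_f_f)
    then show "x f = y f" using fun_cong[OF e, of "\<pi> ` f"] by (simp add: node_action_def)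
  qed
qed

lemma finite_complete_edges: "finite (complete_edges n)"
  by (rule finite_subset[of _ "Pow {1..n}"]) (auto simp: complete_edges_def)

lemma finite_matchings: "finite (matchings l n)"
  by (rule finite_subset[of _ "Pow (complete_edges n)"])
    (auto simp: matchings_def finite_complete_edges)

lemma complete_edges_iff: "e \<in> complete_edges n \<longleftrightarrow> card e = 2 \<and> e \<subseteq> {1..n}"
proof
  show "e \<in> complete_edges n \<Longrightarrow> card e = 2 \<and> e \<subseteq> {1..n}" by (auto simp: complete_edges_def)
next
  assume e: "card e = 2 \<and> e \<subseteq> {1..n}"
  then obtain v w where "e = {v, w}" "v \<noteq> w" by (auto simp: card_2_iff)
  moreover have "v \<in> {1..n}" "w \<in> {1..n}" using e calculation by simp_all
  ultimately show "e \<in> complete_edges n" unfolding complete_edges_def by blast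
qed

lemma card_Union_matching:
  assumes "disjoint M" "\<And>e. e \<in> M \<Longrightarrow> card e = 2"
  shows "card (\<Union>M) = 2 * card M"
proof -
  have "card (\<Union>M) = sum card M"
    using assms by (intro card_Union_disjoint) (auto intro: card_ge_0_finite)
  then show ?thesis using assms(2) by simp
qed

lemma perfect_matchings_subset_matchings:
  assumes "X \<subseteq> {1..n}" "card X = 2 * l"
  shows "perfect_matchings X \<subseteq> matchings l n"
  using assms card_Union_matching
  by (fastforce simp: perfect_matchings_def matchings_def complete_edges_iff)

lemma indicator_in_match_polytope:
  "M \<in> matchings l n \<Longrightarrow> indicator M \<in> match_polytope l n"
  unfolding match_polytope_def by (intro hull_inc imageI)

lemma sum_indicator_eq_card_Int: "finite D \<Longrightarrow> sum (indicator M) D = real (card (D \<inter> M))"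
  by (simp add: indicator_def)

lemma indicator_inject:
  assumes "(indicator A :: 'a \<Rightarrow> real) = indicator B"
  shows "A = B"
proof (rule set_eqI)
  fix x
  have "x \<in> A \<longleftrightarrow> indicator A x = (1 :: real)" by (simp add: indicator_def)
  also have "\<dots> \<longleftrightarrow> indicator B x = (1 :: real)" by (simp only: assms)
  also have "\<dots> \<longleftrightarrow> x \<in> B" by (simp add: indicator_def)
  finally show "x \<in> A \<longleftrightarrow> x \<in> B" .
qed

section \<open>Consequences of a symmetric subspace extension\<close>

locale symmetric_subspace_extension =
  fixes n l d :: nat and Q :: "(nat \<Rightarrow> real) set" and p :: "(nat \<Rightarrow> real) \<Rightarrow> (nat set \<Rightarrow> real)"
  assumes extension: "is_subspace_extension d Q p (complete_edges n) (match_polytope l n)"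
    and symmetric: "coordinate_symmetric d Q p (node_symmetries n)"
begin

lemma image_p: "p ` Q = match_polytope l n"
  using extension by (simp add: is_subspace_extension_def is_extension_def)

lemma Q_nonneg: "y \<in> Q \<Longrightarrow> j \<in> {1..d} \<Longrightarrow> 0 \<le> y j"
  using extension by (auto simp: is_subspace_extension_def nonneg_orthant_def)

lemma Q_coord_space: "y \<in> Q \<Longrightarrow> y \<in> coord_space {1..d}"
  using extension by (auto simp: is_subspace_extension_def)

lemma p_affine:
  obtains f c where "linear f" "\<And>y. y \<in> Q \<Longrightarrow> p y = f y + c"
  using extension Q_coord_space
  by (auto simp: is_subspace_extension_def is_extension_def affine_map_def)

text \<open>This is where the form of a subspace extension enters: the affine equations survive
  every affine combination, so nonnegativity of the coordinates alone decides membership in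
  \<open>Q\<close>.\<close>

lemma affine_combination_in_Q:
  assumes y: "\<And>i. i \<in> I \<Longrightarrow> y i \<in> Q" and c: "sum c I = (1::real)"
    and nonneg: "\<And>j. j \<in> {1..d} \<Longrightarrow> 0 \<le> (\<Sum>i\<in>I. c i * y i j)"
  shows "(\<Sum>i\<in>I. c i *\<^sub>R y i) \<in> Q"
    and "p (\<Sum>i\<in>I. c i *\<^sub>R y i) = (\<Sum>i\<in>I. c i *\<^sub>R p (y i))"
proof -
  let ?s = "\<Sum>i\<in>I. c i *\<^sub>R y i"
  obtain A where A: "affine A" "A \<subseteq> coord_space {1..d}" "Q = A \<inter> nonneg_orthant {1..d}"
    using extension by (auto simp: is_subspace_extension_def)
  have "?s \<in> A" using y A by (intro affine_combination_in c) auto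
  moreover have "?s \<in> nonneg_orthant {1..d}"
    using calculation A(2) nonneg by (auto simp: nonneg_orthant_def sum_fun_apply)
  ultimately show s: "?s \<in> Q" using A(3) by simp
  obtain f b where f: "linear f" "\<And>y. y \<in> Q \<Longrightarrow> p y = f y + b" using p_affine by blast
  have "p ?s = (\<Sum>i\<in>I. c i *\<^sub>R f (y i)) + sum c I *\<^sub>R b"
    using f(2)[OF s] c by (simp add: linear_sum[OF f(1)] linear_cmul[OF f(1)])
  also have "\<dots> = (\<Sum>i\<in>I. c i *\<^sub>R p (y i))"
    using f(2) y by (simp add: scaleR_add_right sum.distrib scaleR_sum_left)
  finally show "p ?s = (\<Sum>i\<in>I. c i *\<^sub>R p (y i))" .
qed

lemma symmetry:
  assumes "\<pi> permutes {1..n}"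
  obtains \<kappa> where "\<kappa> permutes {1..d}" "permute_coords \<kappa> ` Q = Q"
    "\<And>y. y \<in> Q \<Longrightarrow> p (permute_coords \<kappa> y) = node_action \<pi> (p y)"
  using symmetric assms unfolding coordinate_symmetric_def node_symmetries_def by blast

text \<open>
  The section consists of the barycenters of the fibres of \<open>p\<close> in a finite set \<open>Orb\<close> that is
  closed under all coordinate permutations preserving \<open>Q\<close>, so the permutations in
  \<^const>\<open>coordinate_symmetric\<close> need not form a group.
\<close>

lemma equivariant_section:
  "\<exists>s. (\<forall>M\<in>matchings l n. s M \<in> Q \<and> p (s M) = indicator M) \<and>
    (\<forall>\<pi>. \<pi> permutes {1..n} \<longrightarrow>
      (\<exists>\<kappa>. \<kappa> permutes {1..d} \<and> (\<forall>M\<in>matchings l n. s ((`) \<pi> ` M) = permute_coords \<kappa> (s M))))"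
proof -
  have "\<exists>y. y \<in> Q \<and> p y = indicator M" if "M \<in> matchings l n" for M
    using indicator_in_match_polytope[OF that] image_p by (metis imageE)
  then obtain y0 where y0: "\<And>M. M \<in> matchings l n \<Longrightarrow> y0 M \<in> Q \<and> p (y0 M) = indicator M"
    by metis
  define Orb where "Orb = Q \<inter>
    (\<lambda>(\<kappa>, M). permute_coords \<kappa> (y0 M)) ` ({\<kappa>. \<kappa> permutes {1..d}} \<times> matchings l n)"
  have finO: "finite Orb"
    unfolding Orb_def by (simp add: finite_permutations finite_matchings)
  define Fib where "Fib M = {y \<in> Orb. p y = indicator M}" for M :: "nat set set"
  define s where "s M = (\<Sum>y\<in>Fib M. (1 / real (card (Fib M))) *\<^sub>R y)" for M
  have finF: "finite (Fib M)" for M using finO by (simp add: Fib_def)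
  have "y0 M \<in> Fib M" if "M \<in> matchings l n" for M
  proof -
    have "permute_coords id (y0 M) = y0 M" by (simp add: permute_coords_def)
    then show ?thesis using y0[OF that] that
      by (auto simp: Fib_def Orb_def intro!: image_eqI[of _ _ "(id, M)"] permutes_id)
  qed
  then have card: "0 < card (Fib M)" if "M \<in> matchings l n" for M
    using finF that by (auto simp: card_gt_0_iff)
  have FQ: "y \<in> Q" "p y = indicator M" if "y \<in> Fib M" for y M
    using that by (auto simp: Fib_def Orb_def)
  have s: "s M \<in> Q" "p (s M) = indicator M" if M: "M \<in> matchings l n" for M
  proof -
    have c: "(\<Sum>y\<in>Fib M. 1 / real (card (Fib M))) = 1" using card[OF M] by simp
    have nn: "0 \<le> (\<Sum>y\<in>Fib M. 1 / real (card (Fib M)) * y j)" if "j \<in> {1..d}" for j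
      using Q_nonneg[OF FQ(1) that] by (intro sum_nonneg) simp
    show "s M \<in> Q"
      unfolding s_def using affine_combination_in_Q(1)[of "Fib M" "\<lambda>y. y", OF FQ(1) c nn] by simp
    have "p (s M) = (\<Sum>y\<in>Fib M. (1 / real (card (Fib M))) *\<^sub>R p y)"
      unfolding s_def using affine_combination_in_Q(2)[of "Fib M" "\<lambda>y. y", OF FQ(1) c nn] by simp
    also have "\<dots> = (\<Sum>y\<in>Fib M. (1 / real (card (Fib M))) *\<^sub>R indicator M)"
      by (intro sum.cong) (auto simp: FQ(2))
    also have "\<dots> = (\<Sum>y\<in>Fib M. 1 / real (card (Fib M))) *\<^sub>R indicator M"
      by (rule scaleR_sum_left[symmetric])
    also have "\<dots> = indicator M" unfolding c by simp
    finally show "p (s M) = indicator M" .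
  qed
  have eq: "\<exists>\<kappa>. \<kappa> permutes {1..d} \<and> (\<forall>M\<in>matchings l n. s ((`) \<pi> ` M) = permute_coords \<kappa> (s M))"
    if \<pi>: "\<pi> permutes {1..n}" for \<pi>
  proof -
    obtain \<kappa> where \<kappa>: "\<kappa> permutes {1..d}" "permute_coords \<kappa> ` Q = Q"
      "\<And>y. y \<in> Q \<Longrightarrow> p (permute_coords \<kappa> y) = node_action \<pi> (p y)"
      using symmetry[OF \<pi>] by blast
    let ?K = "permute_coords \<kappa>"
    have inj: "inj_on ?K Z" for Z using inj_permute_coords[OF \<kappa>(1)] by (rule inj_on_subset) simp
    have "?K ` Orb \<subseteq> Orb"
    proof
      fix y assume "y \<in> ?K ` Orb"
      then obtain \<kappa>' M where *: "y = ?K (permute_coords \<kappa>' (y0 M))" "\<kappa>' permutes {1..d}"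
        "M \<in> matchings l n" "y \<in> Q"
        using \<kappa>(2) by (auto simp: Orb_def)
      then have "y = permute_coords (\<kappa> \<circ> \<kappa>') (y0 M)" using permute_coords_comp[OF \<kappa>(1)] by simp
      then show "y \<in> Orb" using * \<kappa>(1)
        by (auto simp: Orb_def permutes_compose intro!: image_eqI[of _ _ "(\<kappa> \<circ> \<kappa>', M)"])
    qed
    then have KO: "?K ` Orb = Orb" using finO inj by (intro endo_inj_surj)
    \<comment> \<open>Since \<open>permute_coords \<kappa>\<close> is a bijection of
      \<open>Orb\<close> compatible with \<open>p\<close>, it carries the fibre over
      \<open>M\<close> onto the fibre over the image of \<open>M\<close>, and therefore barycenter
      to barycenter.\<close>
    have KF: "Fib ((`) \<pi> ` M) = ?K ` Fib M" for M
    proof -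
      have "p (?K y) = indicator ((`) \<pi> ` M) \<longleftrightarrow> p y = indicator M" if "y \<in> Orb" for y
      proof -
        have "p (?K y) = node_action \<pi> (p y)" using that \<kappa>(3) by (auto simp: Orb_def)
        then show ?thesis
          using node_action_indicator[OF \<pi>, of M] inj_node_action[OF \<pi>] by (metis injD)
      qed
      then have "?K ` Fib M = {y \<in> ?K ` Orb. p y = indicator ((`) \<pi> ` M)}"
        unfolding Fib_def by blast
      then show ?thesis by (simp add: KO Fib_def)
    qed
    have "s ((`) \<pi> ` M) = ?K (s M)" for M
      unfolding s_def KF permute_coords_sum by (simp add: sum.reindex[OF inj] card_image[OF inj])
    then show ?thesis using \<kappa>(1) by blast
  qed
  show ?thesis
  proof (rule exI[of _ s], intro conjI ballI allI impI)
    fix M assume M: "M \<in> matchings l n"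
    show "s M \<in> Q" using M by (rule s)
    show "p (s M) = indicator M" using M by (rule s)
  next
    fix \<pi> assume "\<pi> permutes {1..n}"
    then show "\<exists>\<kappa>. \<kappa> permutes {1..d} \<and>
        (\<forall>M\<in>matchings l n. s ((`) \<pi> ` M) = permute_coords \<kappa> (s M))" by (rule eq)
  qed
qed

text \<open>The stabilizer \<open>U\<close> of the function M \<mapsto> s(M)_j has index at most
  \<open>d\<close>, because each translate of that function is again one of the \<open>d\<close>
  coordinate functions. The theorem on groups of small index then supplies \<open>Z\<close>.\<close>

lemma coordinate_local:
  assumes s: "\<And>\<pi>. \<pi> permutes {1..n} \<Longrightarrow>
      \<exists>\<kappa>. \<kappa> permutes {1..d} \<and> (\<forall>M\<in>matchings l n. s ((`) \<pi> ` M) = permute_coords \<kappa> (s M))"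
    and j: "j \<in> {1..d}" and n: "4 * k + 2 \<le> n" "\<not> (n = 6 \<and> k = 1)" and d: "d \<le> n choose k"
  obtains Z where "Z \<subseteq> {1..n}" "card ({1..n} - Z) \<le> k"
    "\<And>a b c M. distinct [a, b, c] \<Longrightarrow> {a, b, c} \<subseteq> Z \<Longrightarrow> M \<in> matchings l n \<Longrightarrow>
      s ((`) (cyc3 a b c) ` M) j = s M j"
proof -
  let ?Sym = "{\<pi>. \<pi> permutes {1..n}}"
  define U where "U = {\<pi> \<in> ?Sym. \<forall>M\<in>matchings l n. s ((`) \<pi> ` M) j = s M j}"
  have im: "(`) \<pi> ` M \<in> matchings l n" if "\<pi> permutes {1..n}" "M \<in> matchings l n" for \<pi> M
    using image_matching that by blast
  have inv1: "(`) \<pi> ` (`) (inv \<pi>) ` M = M" if "\<pi> permutes {1..n}" for \<pi> and M :: "nat set set"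
    using permutes_inverses(1)[OF that] by (simp add: image_image)
  have "s ((`) (g \<circ> h) ` M) j = s M j" if "g \<in> U" "h \<in> U" "M \<in> matchings l n" for g h M
  proof -
    have "(`) (g \<circ> h) ` M = (`) g ` (`) h ` M" by (simp add: image_image image_comp)
    then show ?thesis using that im[of h M] by (simp add: U_def)
  qed
  moreover have "s ((`) (inv g) ` M) j = s M j" if "g \<in> U" "M \<in> matchings l n" for g M
  proof -
    have g: "g permutes {1..n}" using that by (simp add: U_def)
    have "(`) (inv g) ` M \<in> matchings l n" using im[OF permutes_inv[OF g] that(2)] .
    then have "s ((`) g ` (`) (inv g) ` M) j = s ((`) (inv g) ` M) j" using that(1) by (simp add: U_def)
    then show ?thesis by (simp add: inv1[OF g])
  qed
  ultimately have U: "perm_group {1..n} U"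
    unfolding perm_group_def by (auto simp: U_def permutes_id permutes_compose permutes_inv)
  \<comment> \<open>\<open>f \<pi>\<close> is the j-th coordinate function translated by
    \<open>\<pi>\<close>, and \<open>t i\<close> is the i-th one. The default 0 makes equality of
    functions mean equality on matchings.\<close>
  define f where "f \<pi> = (\<lambda>M. if M \<in> matchings l n then s ((`) (inv \<pi>) ` M) j else 0)" for \<pi>
  define t where "t i = (\<lambda>M. if M \<in> matchings l n then s M i else 0)" for i
  have "f ` ?Sym \<subseteq> t ` {1..d}"
  proof
    fix h assume "h \<in> f ` ?Sym"
    then obtain \<pi> where \<pi>: "\<pi> permutes {1..n}" "h = f \<pi>" by blast
    obtain \<kappa> where \<kappa>: "\<kappa> permutes {1..d}"
      "\<And>M. M \<in> matchings l n \<Longrightarrow> s ((`) (inv \<pi>) ` M) = permute_coords \<kappa> (s M)"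
      using s[OF permutes_inv[OF \<pi>(1)]] by blast
    have "h = t (inv \<kappa> j)"
      using \<kappa>(2) by (auto simp: \<pi>(2) f_def t_def permute_coords_def)
    moreover have "inv \<kappa> j \<in> {1..d}" using permutes_in_image[OF permutes_inv[OF \<kappa>(1)]] j by blast
    ultimately show "h \<in> t ` {1..d}" by blast
  qed
  then have "card (f ` ?Sym) \<le> card (t ` {1..d})" by (intro card_mono) auto
  also have "\<dots> \<le> d" using card_image_le[of "{1..d}" t] by simp
  finally have cf: "card (f ` ?Sym) \<le> n choose k" using d by linarith
  have "card ?Sym \<le> card (f ` ?Sym) * card U"
  proof (rule card_le_image_times_card[OF perm_group_Sym])
    show "finite U" using perm_group_finite[OF U] by simp
    fix g h assume gh: "g \<in> ?Sym" "h \<in> ?Sym" and e: "f g = f h"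
    have g: "g permutes {1..n}" and h: "h permutes {1..n}" using gh by auto
    have "s ((`) (inv g \<circ> h) ` M) j = s M j" if M: "M \<in> matchings l n" for M
    proof -
      have "(`) (inv g \<circ> h) ` M = (`) (inv g) ` (`) h ` M" by (simp add: image_image image_comp)
      moreover have "s ((`) (inv g) ` (`) h ` M) j = s ((`) (inv h) ` (`) h ` M) j"
        using fun_cong[OF e, of "(`) h ` M"] im[OF h M] by (simp add: f_def)
      moreover have "(`) (inv h) ` (`) h ` M = M"
        using permutes_inverses(2)[OF h] by (simp add: image_image)
      ultimately show ?thesis by simp
    qed
    then show "inv g \<circ> h \<in> U" using g h by (simp add: U_def permutes_compose permutes_inv)
  qed simp
  then have "card ?Sym \<le> (n choose k) * card U" using cf by (meson le_trans mult_le_mono1)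
  then have "fact (card {1..n}) \<le> (card {1..n} choose k) * card U"
    using card_permutations[of "{1..n}" n] by simp
  then obtain Z where Z: "Z \<subseteq> {1..n}" "card {1..n} \<le> card Z + k" "contains_alt U Z"
    using small_index_contains_alt[OF _ U, of k] n by auto
  have "card ({1..n} - Z) \<le> k" using Z(1,2) by (simp add: card_Diff_subset finite_subset)
  moreover have "s ((`) (cyc3 a b c) ` M) j = s M j"
    if "distinct [a, b, c]" "{a, b, c} \<subseteq> Z" "M \<in> matchings l n" for a b c M
    using contains_altD[OF Z(3), of a b c] that by (auto simp: U_def)
  ultimately show ?thesis using that Z(1) by blast
qed

text \<open>A matching has at most k edges inside a set of 2k + 1 nodes, so \<open>A\<close> and
  \<open>B\<close> together contain at most 2k of its l = 2k + 1 edges. The resulting linear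
  inequality passes to the convex hull.\<close>

lemma odd_cut_inequality:
  assumes l: "l = 2 * k + 1" and A: "card A = l" and B: "card B = l" and x: "x \<in> match_polytope l n"
  shows "1 \<le> (\<Sum>e\<in>{e \<in> complete_edges n. \<not> e \<subseteq> A \<and> \<not> e \<subseteq> B}. x e)"
proof -
  let ?D = "{e \<in> complete_edges n. \<not> e \<subseteq> A \<and> \<not> e \<subseteq> B}"
  have finD: "finite ?D" using finite_complete_edges by simp
  have "match_polytope l n \<subseteq> {x. 1 \<le> sum x ?D}"
    unfolding match_polytope_def
  proof (rule hull_minimal)
    show "convex {x :: nat set \<Rightarrow> real. 1 \<le> sum x ?D}"
    proof (rule convexI, clarsimp)
      fix x y :: "nat set \<Rightarrow> real" and u v :: real
      assume h: "1 \<le> sum x ?D" "1 \<le> sum y ?D" "0 \<le> u" "0 \<le> v" "u + v = 1"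
      have "u * 1 + v * 1 \<le> u * sum x ?D + v * sum y ?D"
        using h by (intro add_mono mult_left_mono)
      then show "1 \<le> (\<Sum>e\<in>?D. u * x e + v * y e)"
        using h by (simp add: sum.distrib sum_distrib_left)
    qed
    show "(\<lambda>M. indicator M) ` matchings l n \<subseteq> {x :: nat set \<Rightarrow> real. 1 \<le> sum x ?D}"
    proof clarify
      fix M assume M: "M \<in> matchings l n"
      have half: "2 * card {e \<in> M. e \<subseteq> V} \<le> 2 * k" if "card V = l" for V
      proof -
        have "disjoint {e \<in> M. e \<subseteq> V}" using M by (auto simp: matchings_def disjoint_def)
        then have "card (\<Union>{e \<in> M. e \<subseteq> V}) = 2 * card {e \<in> M. e \<subseteq> V}"
          using M by (intro card_Union_matching) (auto simp: matchings_def complete_edges_iff)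
        moreover have "card (\<Union>{e \<in> M. e \<subseteq> V}) \<le> card V"
          using that l by (intro card_mono card_ge_0_finite) auto
        ultimately show ?thesis using that l by simp
      qed
      have "M \<inter> ?D \<noteq> {}"
      proof
        assume "M \<inter> ?D = {}"
        then have "M = {e \<in> M. e \<subseteq> A} \<union> {e \<in> M. e \<subseteq> B}" using M by (auto simp: matchings_def)
        then have "card M \<le> card {e \<in> M. e \<subseteq> A} + card {e \<in> M. e \<subseteq> B}" by (metis card_Un_le)
        moreover have "card M = l" using M by (simp add: matchings_def)
        ultimately show False using half[OF A] half[OF B] l by linarith
      qed
      then have "1 \<le> card (?D \<inter> M)" using finD by (simp add: Suc_leI card_gt_0_iff Int_commute)
      then show "1 \<le> sum (indicator M :: nat set \<Rightarrow> real) ?D" using sum_indicator_eq_card_Int[OF finD, of M] by simp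
    qed
  qed
  then show ?thesis using x by blast
qed

lemma no_small_extension:
  assumes l: "l = 2 * k + 1" and k: "1 \<le> k" and n: "2 * l \<le> n" "\<not> (n = 6 \<and> k = 1)"
    and d: "d \<le> n choose k"
  shows False
proof -
  define X where "X = {1..2 * l}"
  define A where "A = {1..l}"
  have X: "finite X" "X \<subseteq> {1..n}" "card X = 2 * l" using n by (auto simp: X_def)
  have XA: "X \<inter> A = A" "card A = l" "card (X - A) = l"
    by (auto simp: X_def A_def card_Diff_subset)
  have PM: "perfect_matchings X \<subseteq> matchings l n" using perfect_matchings_subset_matchings X by blast
  obtain s where s: "\<And>M. M \<in> matchings l n \<Longrightarrow> s M \<in> Q"
    "\<And>M. M \<in> matchings l n \<Longrightarrow> p (s M) = indicator M"
    "\<And>\<pi>. \<pi> permutes {1..n} \<Longrightarrow>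
      \<exists>\<kappa>. \<kappa> permutes {1..d} \<and> (\<forall>M\<in>matchings l n. s ((`) \<pi> ` M) = permute_coords \<kappa> (s M))"
    using equivariant_section by metis
  \<comment> \<open>These are the odd numbers up to \<open>l\<close>, the crossing numbers that
    occur between two sets of odd size \<open>l\<close>; there are just enough for degree k.\<close>
  define I where "I = (\<lambda>m. 2 * m + 1) ` {0..k}"
  have I: "finite I" "card I = Suc k" by (auto simp: I_def card_image inj_on_def)
  obtain \<alpha> where \<alpha>: "\<And>q. degree q \<le> k \<Longrightarrow> (\<Sum>i\<in>I. \<alpha> i * poly q (real i)) = poly q 0"
    using polynomial_extrapolation[OF I] by blast
  have \<nu>: "num_matchings l l i \<noteq> 0" if "i \<in> I" for i
    using num_matchings_pos[of i l l] that l by (auto simp: I_def)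
  \<comment> \<open>These signed weights imitate an average over matchings with no crossing edge:
    they average over each class with i crossings and extrapolate the averages to i = 0.\<close>
  define c where "c M = (\<Sum>i\<in>I. if crossings A M = i then \<alpha> i / num_matchings l l i else 0)" for M
  have c: "(\<Sum>M\<in>perfect_matchings X. c M * \<psi> M) = poly q 0"
    if "degree q \<le> k" "\<And>i. matching_sum A X i \<psi> = num_matchings l l i * poly q (real i)" for \<psi> q
  proof -
    have "(\<Sum>M\<in>perfect_matchings X. c M * \<psi> M) = (\<Sum>M\<in>perfect_matchings X. \<Sum>i\<in>I.
        \<alpha> i / num_matchings l l i * (if crossings A M = i then \<psi> M else 0))"
      unfolding c_def sum_distrib_right by (intro sum.cong) auto
    also have "\<dots> = (\<Sum>i\<in>I. \<alpha> i / num_matchings l l i * matching_sum A X i \<psi>)"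
      unfolding matching_sum_def sum_distrib_left by (rule sum.swap)
    also have "\<dots> = (\<Sum>i\<in>I. \<alpha> i * poly q (real i))"
      using \<nu> by (intro sum.cong) (simp_all add: that(2))
    finally show ?thesis using \<alpha>[OF that(1)] by simp
  qed
  have one: "matching_sum A X i (\<lambda>_. 1) = num_matchings l l i" for i
    using matching_sum_one[OF X(1), of A i] XA by simp
  have c1: "sum c (perfect_matchings X) = 1"
    using c[of "1" "\<lambda>_. 1"] one by simp
  \<comment> \<open>The average crossing number is the polynomial i, whose degree 1 is within the
    allowed k, and its value at 0 is 0.\<close>
  have c0: "(\<Sum>M\<in>perfect_matchings X. c M * real (crossings A M)) = 0"
  proof -
    have "matching_sum A X i (\<lambda>M. real (crossings A M)) = matching_sum A X i (\<lambda>_. 1) * real i" for i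
      unfolding matching_sum_def sum_distrib_right by (intro sum.cong) auto
    then show ?thesis using c[of "[:0, 1:]" "\<lambda>M. real (crossings A M)"] k by (simp add: one)
  qed
  have nonneg: "0 \<le> (\<Sum>M\<in>perfect_matchings X. c M * s M j)" if j: "j \<in> {1..d}" for j
  proof -
    have n4: "4 * k + 2 \<le> n" using l n by simp
    obtain Z where Z: "Z \<subseteq> {1..n}" "card ({1..n} - Z) \<le> k"
      "\<And>a b c M. distinct [a, b, c] \<Longrightarrow> {a, b, c} \<subseteq> Z \<Longrightarrow> M \<in> matchings l n \<Longrightarrow>
        s ((`) (cyc3 a b c) ` M) j = s M j"
      using coordinate_local[OF s(3) j n4 n(2) d] by blast
    let ?W = "{1..n} - Z"
    have "\<exists>q. degree q \<le> card ?W \<and>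
      (\<forall>i. matching_sum A X i (\<lambda>M. s M j) = num_matchings (card (X \<inter> A)) (card (X - A)) i * poly q (real i)) \<and>
      (2 * card ?W \<le> card (X \<inter> A) \<and> 2 * card ?W \<le> card (X - A) \<longrightarrow> 0 \<le> poly q 0)"
    proof (rule matching_sum_polynomial)
      show "0 \<le> s M j" if "M \<in> perfect_matchings X" for M
        using that PM s(1) Q_nonneg j by blast
      show "s (R \<union> M) j = s (R \<union> M') j"
        if "Y \<union> V = X" "Y \<inter> V = {}" "V \<inter> ?W = {}" "R \<in> perfect_matchings Y"
          "M \<in> perfect_matchings V" "M' \<in> perfect_matchings V" for Y V R M M'
      proof (rule cyc3_invariant_on_perfect_matchings[where \<phi> = "\<lambda>M. s M j" and V = X])
        show "s ((`) (cyc3 a b c) ` N) j = s N j"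
          if "distinct [a, b, c]" "{a, b, c} \<subseteq> Z" "N \<in> perfect_matchings X" for a b c N
          using Z(3) that PM by blast
        show "finite V" "V \<subseteq> Z" using that X(1,2) finite_subset by blast+
      qed (use that in auto)
    qed (use X in auto)
    then obtain q where q: "degree q \<le> card ?W"
      "\<And>i. matching_sum A X i (\<lambda>M. s M j) = num_matchings l l i * poly q (real i)"
      "2 * card ?W \<le> l \<Longrightarrow> 0 \<le> poly q 0"
      using XA by auto
    have "degree q \<le> k" using q(1) Z(2) by linarith
    then have "(\<Sum>M\<in>perfect_matchings X. c M * s M j) = poly q 0" using c q(2) by blast
    \<comment> \<open>At most k nodes lie outside \<open>Z\<close>, and 2k < l is the size condition
      for both sides.\<close>
    moreover have "0 \<le> poly q 0" using q(3) Z(2) l by simp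
    ultimately show ?thesis by simp
  qed
  let ?y = "\<Sum>M\<in>perfect_matchings X. c M *\<^sub>R s M"
  have sQ: "s M \<in> Q" if "M \<in> perfect_matchings X" for M using that PM s(1) by blast
  note y = affine_combination_in_Q[OF sQ c1 nonneg]
  have "p ?y \<in> match_polytope l n" using y(1) image_p by blast
  then have "1 \<le> (\<Sum>e\<in>{e \<in> complete_edges n. \<not> e \<subseteq> A \<and> \<not> e \<subseteq> X - A}. p ?y e)"
    by (rule odd_cut_inequality[OF l XA(2,3)])
  also have "\<dots> = (\<Sum>e\<in>{e \<in> complete_edges n. \<not> e \<subseteq> A \<and> \<not> e \<subseteq> X - A}.
      \<Sum>M\<in>perfect_matchings X. c M * indicator M e)"
  proof (rule sum.cong[OF refl])
    fix e
    have "p ?y e = (\<Sum>M\<in>perfect_matchings X. c M *\<^sub>R p (s M)) e" using y(2) by simp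
    also have "\<dots> = (\<Sum>M\<in>perfect_matchings X. c M * indicator M e)"
      unfolding sum_fun_apply using PM s(2) by (intro sum.cong) auto
    finally show "p ?y e = (\<Sum>M\<in>perfect_matchings X. c M * indicator M e)" .
  qed
  also have "\<dots> = (\<Sum>M\<in>perfect_matchings X. c M *
      (\<Sum>e\<in>{e \<in> complete_edges n. \<not> e \<subseteq> A \<and> \<not> e \<subseteq> X - A}. indicator M e))"
    unfolding sum_distrib_left by (rule sum.swap)
  also have "\<dots> = (\<Sum>M\<in>perfect_matchings X. c M * real (crossings A M))"
  proof (rule sum.cong[OF refl])
    fix M assume M: "M \<in> perfect_matchings X"
    then have "M \<subseteq> complete_edges n" "\<Union>M = X" using PM by (auto simp: matchings_def perfect_matchings_def)
    \<comment> \<open>All edges of \<open>M\<close> lie in \<open>X\<close>, so its edges in the cut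
      are its crossing edges. The cut value of \<open>p ?y\<close> is therefore 0 instead of at
      least 1.\<close>
    then have "{e \<in> complete_edges n. \<not> e \<subseteq> A \<and> \<not> e \<subseteq> X - A} \<inter> M = {e \<in> M. \<not> e \<subseteq> A \<and> \<not> e \<subseteq> - A}"
      by auto
    then show "c M * (\<Sum>e\<in>{e \<in> complete_edges n. \<not> e \<subseteq> A \<and> \<not> e \<subseteq> X - A}. indicator M e)
        = c M * real (crossings A M)"
      using finite_complete_edges[of n] by (simp add: crossings_def sum_indicator_eq_card_Int)
  qed
  finally show False using c0 by simp
qed

text \<open>A dimension bound: the matrix of the incidences \<open>e i \<in> M j\<close> is triangular.\<close>

lemma triangular_matchings_bound:
  assumes M: "\<And>i. i < m \<Longrightarrow> M i \<in> matchings l n" and e: "\<And>i. i < m \<Longrightarrow> e i \<in> M i"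
    and tri: "\<And>i j. i < j \<Longrightarrow> j < m \<Longrightarrow> e i \<notin> M j"
  shows "m \<le> Suc d"
proof (rule ccontr)
  assume m: "\<not> m \<le> Suc d"
  have "\<exists>y. y \<in> Q \<and> p y = indicator (M i)" if "i < m" for i
    using indicator_in_match_polytope[OF M[OF that]] image_p by (metis imageE)
  then obtain y where y: "\<And>i. i < m \<Longrightarrow> y i \<in> Q" "\<And>i. i < m \<Longrightarrow> p (y i) = indicator (M i)"
    by metis
  have yM: "M i = M j" if "y i = y j" "i < m" "j < m" for i j
  proof -
    have "(indicator (M i) :: nat set \<Rightarrow> real) = indicator (M j)" using y(2) that by metis
    then show ?thesis by (rule indicator_inject)
  qed
  define v where "v i = (\<lambda>j. if j = 0 then 1 else y i j)" for i
  have yv: "y i = y j" if "v i = v j" "i < m" "j < m" for i j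
  proof
    fix t
    have "y i 0 = 0" "y j 0 = 0" using Q_coord_space y(1) that by (auto simp: coord_space_def)
    then show "y i t = y j t" using fun_cong[OF that(1), of t] by (cases "t = 0") (auto simp: v_def)
  qed
  have inj: "inj_on v {..<m}"
  proof (rule linorder_inj_onI)
    fix i j assume ij: "i < j" "i \<in> {..<m}" "j \<in> {..<m}"
    show "v i \<noteq> v j"
    proof
      assume "v i = v j"
      then have "M i = M j" using ij by (intro yM yv) auto
      then show False using e[of i] tri[of i j] ij by simp
    qed
  qed auto
  define b where "b t = (\<lambda>j. if j = t then 1 else 0 :: real)" for t :: nat
  have "v ` {..<m} \<subseteq> span (b ` {0..d})"
  proof
    fix x assume "x \<in> v ` {..<m}"
    then obtain i where i: "i < m" "x = v i" by auto
    have "x = (\<Sum>t\<in>{0..d}. x t *\<^sub>R b t)"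
    proof
      fix j
      have "x j = 0" if "j \<notin> {0..d}"
        using that Q_coord_space[OF y(1)[OF i(1)]] by (auto simp: i(2) v_def coord_space_def)
      then show "x j = (\<Sum>t\<in>{0..d}. x t *\<^sub>R b t) j"
        by (auto simp: sum_fun_apply b_def if_distrib sum.delta cong: if_cong)
    qed
    moreover have "(\<Sum>t\<in>{0..d}. x t *\<^sub>R b t) \<in> span (b ` {0..d})"
      by (intro span_sum span_scale span_base) auto
    ultimately show "x \<in> span (b ` {0..d})" by simp
  qed
  then have "dependent (v ` {..<m})"
    using independent_span_bound[of "b ` {0..d}" "v ` {..<m}"] card_image[OF inj]
      card_image_le[of "{0..d}" b] m by auto
  then obtain u where u: "\<exists>i<m. u (v i) \<noteq> 0" "(\<Sum>x\<in>v ` {..<m}. u x *\<^sub>R x) = 0"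
    using dependent_finite[of "v ` {..<m}"] by auto
  define w where "w i = u (v i)" for i
  have wv: "(\<Sum>i<m. w i *\<^sub>R v i) = 0" using u(2) by (simp add: sum.reindex[OF inj] w_def)
  have w0: "sum w {..<m} = 0" using fun_cong[OF wv, of 0] by (simp add: sum_fun_apply v_def)
  have wy: "(\<Sum>i<m. w i *\<^sub>R y i) = 0"
  proof
    fix j show "(\<Sum>i<m. w i *\<^sub>R y i) j = 0 j"
    proof (cases "j = 0")
      case True
      then show ?thesis using Q_coord_space[OF y(1)] by (auto simp: sum_fun_apply coord_space_def)
    next
      case False
      then show ?thesis using fun_cong[OF wv, of j] by (simp add: sum_fun_apply v_def)
    qed
  qed
  obtain f c where f: "linear f" "\<And>y. y \<in> Q \<Longrightarrow> p y = f y + c" using p_affine by blast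
  have ind: "indicator (M i) = f (y i) + c" if "i < m" for i
    by (rule trans[OF y(2)[OF that, symmetric] f(2)[OF y(1)[OF that]]])
  have "(\<Sum>i<m. w i *\<^sub>R indicator (M i)) = (\<Sum>i<m. w i *\<^sub>R f (y i)) + sum w {..<m} *\<^sub>R c"
    by (simp add: ind scaleR_add_right sum.distrib scaleR_sum_left)
  also have "\<dots> = f (\<Sum>i<m. w i *\<^sub>R y i)"
    using w0 by (simp add: linear_sum[OF f(1)] linear_cmul[OF f(1)])
  also have "\<dots> = 0" using wy linear_0[OF f(1)] by simp
  finally have sum0: "(\<Sum>i<m. w i *\<^sub>R indicator (M i)) = (0 :: nat set \<Rightarrow> real)" .
  have wM: "(\<Sum>i<m. w i * indicator (M i) x) = 0" for x
    using fun_cong[OF sum0, of x] by (simp add: sum_fun_apply)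
  have "\<exists>i. i < m \<and> w i \<noteq> 0" using u(1) by (auto simp: w_def)
  \<comment> \<open>For the least index with nonzero coefficient, the entry at \<open>e i\<close>
    isolates \<open>w i\<close>: earlier terms have coefficient 0 and later matchings avoid
    \<open>e i\<close>.\<close>
  then obtain i where i: "i < m" "w i \<noteq> 0" "\<And>j. j < i \<Longrightarrow> \<not> (j < m \<and> w j \<noteq> 0)"
    unfolding exists_least_iff[of "\<lambda>i. i < m \<and> w i \<noteq> 0"] by blast
  have "(\<Sum>j<m. w j * indicator (M j) (e i)) = (\<Sum>j<m. if j = i then w i else 0)"
  proof (rule sum.cong[OF refl])
    fix j assume "j \<in> {..<m}"
    then show "w j * indicator (M j) (e i) = (if j = i then w i else 0)"
      using i e[OF i(1)] tri[of i j] by (cases i j rule: linorder_cases) auto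
  qed
  then show False using wM[of "e i"] i by simp
qed

end

section \<open>The two exceptional cases\<close>

lemma matching_three:
  assumes d: "distinct [a, b, c, d, e, f]" and "{a, b, c, d, e, f} \<subseteq> {1..n}"
  shows "{{a, b}, {c, d}, {e, f}} \<in> matchings 3 n"
proof -
  have "{a, b} \<noteq> {c, d}" "{a, b} \<noteq> {e, f}" "{c, d} \<noteq> {e, f}"
    using d by (simp_all add: doubleton_eq_iff)
  then have "card {{a, b}, {c, d}, {e, f}} = 3" by simp
  moreover have "disjoint {{a, b}, {c, d}, {e, f}}"
    using d by (auto simp: pairwise_insert disjnt_def)
  moreover have "card {a, b} = 2" "card {c, d} = 2" "card {e, f} = 2" using d by simp_all
  ultimately show ?thesis using assms(2) by (simp add: matchings_def complete_edges_iff)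
qed

text \<open>Eight matchings of size 3, each with a marked edge that all later ones avoid, force d +
  1 \<ge> 8. The number to exceed is 6 choose 1 = 6.\<close>

lemma (in symmetric_subspace_extension) no_small_extension_K6:
  assumes "n = 6" "l = 3"
  shows "7 \<le> d"
proof -
  define L :: "(nat set set \<times> nat set) list" where "L =
    [({{1,4},{2,3},{5,6}}, {2,3}), ({{1,4},{2,5},{3,6}}, {1,4}), ({{1,3},{2,6},{4,5}}, {2,6}),
     ({{1,3},{2,5},{4,6}}, {2,5}), ({{1,3},{2,4},{5,6}}, {1,3}), ({{1,2},{3,6},{4,5}}, {3,6}),
     ({{1,2},{3,5},{4,6}}, {3,5}), ({{1,2},{3,4},{5,6}}, {1,2})]"
  have len: "length L = 8" by (simp add: L_def)
  have M: "fst x \<in> matchings 3 6" and e: "snd x \<in> fst x" if "x \<in> set L" for x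
    using that by (auto simp: L_def intro!: matching_three)
  have tri: "sorted_wrt (\<lambda>x y. snd x \<notin> fst y) L"
    by (simp add: L_def doubleton_eq_iff)
  have "8 \<le> Suc d"
  proof (rule triangular_matchings_bound)
    show "fst (L ! i) \<in> matchings l n" "snd (L ! i) \<in> fst (L ! i)" if "i < 8" for i
      using M[of "L ! i"] e[of "L ! i"] that len assms by simp_all
    show "snd (L ! i) \<notin> fst (L ! j)" if "i < j" "j < 8" for i j
      using sorted_wrt_nth_less[OF tri that(1)] that(2) len by simp
  qed
  then show ?thesis by simp
qed

text \<open>With at most one coordinate, only the identity permutes the coordinates, so every node
  permutation would fix every point of the polytope. The transposition of 1 and 3 moves the edge {1,
  2}. The number to exceed is n choose 0 = 1.\<close>

lemma (in symmetric_subspace_extension) no_small_extension_edges: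
  assumes "3 \<le> n" "l = 1"
  shows "2 \<le> d"
proof (rule ccontr)
  assume "\<not> 2 \<le> d"
  then have d: "d = 0 \<or> d = 1" by auto
  let ?\<pi> = "Transposition.transpose 1 (3::nat)"
  have "?\<pi> permutes {1..n}" (is ?P) using assms by (intro permutes_swap_id) auto
  then obtain \<kappa> where \<kappa>: "\<kappa> permutes {1..d}" "permute_coords \<kappa> ` Q = Q"
    "\<And>y. y \<in> Q \<Longrightarrow> p (permute_coords \<kappa> y) = node_action ?\<pi> (p y)"
    using symmetry[OF \<open>?P\<close>] by blast
  have "{1..d} = {} \<or> {1..d} = {1}" using d by auto
  then have "\<kappa> = id" using \<kappa>(1) by (metis permutes_empty permutes_sing)
  then have id: "permute_coords \<kappa> y = y" for y by (simp add: permute_coords_def)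
  have fixp: "p y = node_action ?\<pi> (p y)" if "y \<in> Q" for y
    using \<kappa>(3)[OF that] unfolding id .
  have "{{1, 2}} \<in> matchings l n" using assms by (auto simp: matchings_def complete_edges_iff)
  then obtain y where "y \<in> Q" "p y = indicator {{1, 2}}"
    using indicator_in_match_polytope image_p by (metis imageE)
  then have "node_action ?\<pi> (indicator {{1, 2}}) = (indicator {{1, 2}} :: nat set \<Rightarrow> real)"
    using fixp by metis
  then have "(indicator ((`) ?\<pi> ` {{1, 2}}) :: nat set \<Rightarrow> real) = indicator {{1, 2}}"
    using node_action_indicator[OF \<open>?P\<close>] by metis
  then have "(`) ?\<pi> ` {{1, 2}} = {{1, 2}}" by (rule indicator_inject)
  then have "?\<pi> ` {1, 2} = {1, 2}" by simp
  then have "?\<pi> 1 \<in> {1, 2}" by blast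
  then show False by simp
qed

theorem theorem15:
  fixes n l :: nat
  assumes "3 \<le> n" and "1 \<le> l" and "odd l" and "real l \<le> real n / 2"
  shows "\<not> (\<exists>(d::nat) Q p.
            is_subspace_extension d Q p (complete_edges n) (match_polytope l n) \<and>
            coordinate_symmetric d Q p (node_symmetries n) \<and>
            d \<le> n choose ((l - 1) div 2))"
proof clarify
  fix d Q p
  assume ext: "is_subspace_extension d Q p (complete_edges n) (match_polytope l n)"
    "coordinate_symmetric d Q p (node_symmetries n)" and d: "d \<le> n choose ((l - 1) div 2)"
  interpret symmetric_subspace_extension n l d Q p using ext by unfold_locales
  obtain k where k: "l = 2 * k + 1" using assms(3) by (rule oddE)
  have ln: "2 * l \<le> n" using assms(4) by linarith
  consider "k = 0" | "n = 6" "k = 1" | "1 \<le> k" "\<not> (n = 6 \<and> k = 1)" by linarith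
  then show False
  proof cases
    case 1
    then show ?thesis using no_small_extension_edges assms(1) d k by simp
  next
    case 2
    then show ?thesis using no_small_extension_K6 d k by simp
  next
    case 3
    then show ?thesis using no_small_extension[OF k 3(1) ln 3(2)] d k by simp
  qed
qed

end
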